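(* Let $\mathcal C$ be the class of nonempty, bounded, open, convex subsets of $\mathbb R^3$, and let $J_{\mathrm{Per}}(\Omega):=\mathrm{Per}(\Omega)\,\lambda_1^{\mathrm{Max}}(\Omega)$ for $\Omega\in\mathcal C$. Then $$m_*:=\inf_{\Omega\in\mathcal C}J_{\mathrm{Per}}(\Omega)>0 .$$
   Context: $\mathrm{Per}(\Omega)$ is the De Giorgi perimeter of $\Omega$ (for a bounded open convex set, the $2$-dimensional Hausdorff measure of $\partial\Omega$). First Maxwell eigenvalue. For $\Omega\subset\mathbb R^3$ nonempty, bounded, open and convex, let $\mathbf H(\operatorname{curl};\Omega)$ be the space of $\mathbf u\in L^2(\Omega)^3$ with distributional $\operatorname{curl}\mathbf u\in L^2(\Omega)^3$, and let $\mathbf H_0(\operatorname{curl};\Omega)$ be the closure of $C_c^\infty(\Omega)^3$ in $\mathbf H(\operatorname{curl};\Omega)$ (equivalently, the fields with zero tangential trace $\mathbf u\times\mathbf n=0$ on $\partial\Omega$). Set $\mathcal S(\Omega):=\{\mathbf E\in\mathbf H_0(\operatorname{curl};\Omega):\operatorname{div}\mathbf E=0\text{ in }\Omega\}$ and $$\lambda_1^{\mathrm{Max}}(\Omega):=\min_{\mathbf E\in\mathcal S(\Omega)\setminus\{0\}}\frac{\int_\Omega|\operatorname{curl}\mathbf E|^2\,dx}{\int_\Omega|\mathbf E|^2\,dx}.$$ *)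

theory Defs
  imports "HOL-Analysis.Analysis"
begin

section \<open>Classical derivatives and test functions on \<open>\<real>\<^sup>3\<close>\<close>

definition partial :: "3 \<Rightarrow> (real^3 \<Rightarrow> 'a::real_normed_vector) \<Rightarrow> real^3 \<Rightarrow> 'a" where
  "partial i f x = frechet_derivative f (at x) (axis i 1)"

primrec iter_partial :: "3 list \<Rightarrow> (real^3 \<Rightarrow> 'a::real_normed_vector) \<Rightarrow> real^3 \<Rightarrow> 'a" where
  "iter_partial [] f = f"
| "iter_partial (i # js) f = partial i (iter_partial js f)"

definition C1 :: "(real^3 \<Rightarrow> 'a::real_normed_vector) \<Rightarrow> bool" where
  "C1 f \<longleftrightarrow> (\<forall>x. f differentiable (at x)) \<and> (\<forall>i. continuous_on UNIV (partial i f))"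

definition smooth :: "(real^3 \<Rightarrow> 'a::real_normed_vector) \<Rightarrow> bool" where
  "smooth f \<longleftrightarrow> (\<forall>js x. iter_partial js f differentiable (at x))"

definition supp :: "(real^3 \<Rightarrow> 'a::real_normed_vector) \<Rightarrow> (real^3) set" where
  "supp f = closure {x. f x \<noteq> 0}"

text \<open>Elements of \<open>C\<^sub>c\<^sup>\<infinity>(\<Omega>)\<close> are represented by their extension by zero to \<open>\<real>\<^sup>3\<close>.\<close>

definition test_fun :: "(real^3) set \<Rightarrow> (real^3 \<Rightarrow> 'a::real_normed_vector) set" where
  "test_fun \<Omega> = {f. smooth f \<and> compact (supp f) \<and> supp f \<subseteq> \<Omega>}"

definition grad :: "(real^3 \<Rightarrow> real) \<Rightarrow> real^3 \<Rightarrow> real^3" where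
  "grad f x = (\<chi> i. partial i f x)"

definition divergence :: "(real^3 \<Rightarrow> real^3) \<Rightarrow> real^3 \<Rightarrow> real" where
  "divergence F x = (\<Sum>i\<in>UNIV. partial i F x $ i)"

definition curl :: "(real^3 \<Rightarrow> real^3) \<Rightarrow> real^3 \<Rightarrow> real^3" where
  "curl F x = vector
     [partial 2 F x $ 3 - partial 3 F x $ 2,
      partial 3 F x $ 1 - partial 1 F x $ 3,
      partial 1 F x $ 2 - partial 2 F x $ 1]"

section \<open>De Giorgi perimeter\<close>

definition perimeter :: "(real^3) set \<Rightarrow> ereal" where
  "perimeter \<Omega> =
     (SUP F \<in> {F :: real^3 \<Rightarrow> real^3. C1 F \<and> compact (supp F) \<and> (\<forall>x. norm (F x) \<le> 1)}.
        ereal (\<integral>x. divergence F x \<partial>lebesgue_on \<Omega>))"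

section \<open>The space \<open>H\<^sub>0(curl; \<Omega>)\<close> and the first Maxwell eigenvalue\<close>

text \<open>
  Elements of \<open>L\<^sup>2(\<Omega>)\<^sup>3\<close> are represented by functions rather than by classes modulo equality
  almost everywhere; values outside \<open>\<Omega>\<close> are irrelevant.
\<close>

definition L2 :: "(real^3) set \<Rightarrow> (real^3 \<Rightarrow> real^3) set" where
  "L2 \<Omega> = {u. u \<in> borel_measurable (lebesgue_on \<Omega>) \<and>
                integrable (lebesgue_on \<Omega>) (\<lambda>x. (norm (u x))\<^sup>2)}"

definition is_weak_curl ::
  "(real^3) set \<Rightarrow> (real^3 \<Rightarrow> real^3) \<Rightarrow> (real^3 \<Rightarrow> real^3) \<Rightarrow> bool" where
  "is_weak_curl \<Omega> u w \<longleftrightarrow>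
     (\<forall>\<phi> \<in> test_fun \<Omega>.
        (\<integral>x. w x \<bullet> \<phi> x \<partial>lebesgue_on \<Omega>) = (\<integral>x. u x \<bullet> curl \<phi> x \<partial>lebesgue_on \<Omega>))"

definition Hcurl :: "(real^3) set \<Rightarrow> (real^3 \<Rightarrow> real^3) set" where
  "Hcurl \<Omega> = {u \<in> L2 \<Omega>. \<exists>w \<in> L2 \<Omega>. is_weak_curl \<Omega> u w}"

text \<open>
  For \<open>u \<in> Hcurl \<Omega>\<close> the weak curl is unique up to a null set, so the choice does not affect
  the integrals below.
\<close>

definition weak_curl :: "(real^3) set \<Rightarrow> (real^3 \<Rightarrow> real^3) \<Rightarrow> real^3 \<Rightarrow> real^3" where
  "weak_curl \<Omega> u = (SOME w. w \<in> L2 \<Omega> \<and> is_weak_curl \<Omega> u w)"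

text \<open>
  Closure of the test fields in the norm of \<open>H(curl; \<Omega>)\<close>; the distributional curl of a test
  field is its classical curl.
\<close>

definition H0curl :: "(real^3) set \<Rightarrow> (real^3 \<Rightarrow> real^3) set" where
  "H0curl \<Omega> = {u \<in> Hcurl \<Omega>. \<forall>\<epsilon>>0. \<exists>\<phi> \<in> test_fun \<Omega>.
     sqrt ((\<integral>x. (norm (u x - \<phi> x))\<^sup>2 \<partial>lebesgue_on \<Omega>) +
           (\<integral>x. (norm (weak_curl \<Omega> u x - curl \<phi> x))\<^sup>2 \<partial>lebesgue_on \<Omega>)) < \<epsilon>}"

definition weak_div_free :: "(real^3) set \<Rightarrow> (real^3 \<Rightarrow> real^3) \<Rightarrow> bool" where
  "weak_div_free \<Omega> u \<longleftrightarrow>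
     (\<forall>\<psi> \<in> test_fun \<Omega>. (\<integral>x. u x \<bullet> grad \<psi> x \<partial>lebesgue_on \<Omega>) = 0)"

definition maxwell_space :: "(real^3) set \<Rightarrow> (real^3 \<Rightarrow> real^3) set" where
  "maxwell_space \<Omega> = {E \<in> H0curl \<Omega>. weak_div_free \<Omega> E}"

text \<open>
  The minimum of the Rayleigh quotient is written as an infimum in the extended reals. A field
  is nonzero in \<open>L\<^sup>2\<close> when it does not vanish almost everywhere in \<open>\<Omega>\<close>.
\<close>

definition maxwell_eigenvalue :: "(real^3) set \<Rightarrow> ereal" where
  "maxwell_eigenvalue \<Omega> =
     (INF E \<in> {E \<in> maxwell_space \<Omega>. \<not> (AE x in lebesgue_on \<Omega>. E x = 0)}.
        ereal ((\<integral>x. (norm (weak_curl \<Omega> E x))\<^sup>2 \<partial>lebesgue_on \<Omega>) /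
               (\<integral>x. (norm (E x))\<^sup>2 \<partial>lebesgue_on \<Omega>)))"

section \<open>The shape functional\<close>

definition convex_domains :: "(real^3) set set" where
  "convex_domains = {\<Omega>. \<Omega> \<noteq> {} \<and> bounded \<Omega> \<and> open \<Omega> \<and> convex \<Omega>}"

definition J_Per :: "(real^3) set \<Rightarrow> ereal" where
  "J_Per \<Omega> = perimeter \<Omega> * maxwell_eigenvalue \<Omega>"

end

theory Submission imports Defs begin

text \<open>
  Let \<open>L\<close> be the diameter of \<open>\<Omega>\<close>, attained at \<open>P\<close> and \<open>Q\<close>, and let \<open>h\<close> be the largest distance of
  a point \<open>R\<close> of the closure of \<open>\<Omega>\<close> from the line \<open>PQ\<close>. The perimeter is bounded below by a
  multiple of the area of the triangle \<open>PQR\<close>, hence of \<open>h * L\<close>, so it suffices to bound the \<open>L\<^sup>2\<close>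
  norm of a Maxwell field \<open>E\<close> by a multiple of \<open>sqrt (h * L)\<close> times that of its curl.

  As \<open>E\<close> is orthogonal to gradients and is a limit of test fields, it is enough to write every test
  field \<open>F\<close> as a gradient plus a remainder controlled by the curl of \<open>F\<close>. Cartan's formula for the
  dilations away from a line parallel to \<open>PQ\<close> (with fixed centres near the two ends) does this: all
  displacements are of order \<open>h\<close>, whatever \<open>L\<close> is. The only obstruction is the singularity of the
  remainder at the centre line. It is removed by choosing the line, depending on \<open>E\<close>, among the
  parallel lines in a strip of width \<open>\<sigma> = h\<^sup>2 / (4 * L)\<close> inside the triangle; by averaging this costs a factor
  \<open>h / \<sigma> = 4 * L / h\<close>, which turns \<open>h\<^sup>2\<close> into a multiple of \<open>h * L\<close>.
\<close>

section \<open>Differential calculus and test functions\<close>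

text \<open>Why the dilations expand: if \<open>g s t x\<close> lies in the support of a test field,
  then \<open>x\<close> lies between that point and a centre in the closure of \<Omega>. By
  convexity the potential in the homotopy formula keeps compact support in \<Omega>, so
  \<open>E\<close> is orthogonal to its gradient. The obstacle: the Jacobian of \<open>g s t\<close>
  is of order t^2 or more, so the curl term at time t has L2 norm of order h / t times that of the
  curl, and its integral over t diverges logarithmically. The missing decay comes from
  \<open>E\<close>: only points within 2 h / t of the plane at height \<open>s\<close> along
  \<open>e2\<close> contribute, and on average over \<open>s\<close> this slab holds at most the
  fraction (4 h / \<sigma>) / t of the square integral of \<open>E\<close>. Cauchy-Schwarz with the
  weight sqrt t then leaves the integral of t^(-3/2) on both sides. The same estimate makes the term
  at t = T vanish as T grows. Constants: averaging gives 8 h / \<sigma>, relaxed to 9 h / \<sigma>;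
  the curl side gives 10 h^2; with \<sigma> = h^2 / (4 L) the product is 360 h L. The perimeter is
  at least h L / 64, and 64 * 360 = 23040.\<close>

lemma partial_eqI:
  assumes "(f has_derivative D) (at x)"
  shows "partial i f x = D (axis i 1)"
  using frechet_derivative_at[OF assms] by (simp add: partial_def)

lemma has_derivative_partials:
  assumes "f differentiable (at x)"
  shows "(f has_derivative (\<lambda>h. \<Sum>i\<in>UNIV. h $ i *\<^sub>R partial i f x)) (at x)"
proof -
  let ?D = "frechet_derivative f (at x)"
  have D: "(f has_derivative ?D) (at x)"
    using assms by (simp add: frechet_derivative_works)
  have lin: "linear ?D"
    using D has_derivative_linear by blast
  have "?D h = (\<Sum>i\<in>UNIV. h $ i *\<^sub>R partial i f x)" for h
  proof -
    have "?D h = ?D (\<Sum>i\<in>UNIV. h $ i *\<^sub>R axis i 1)"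
      using basis_expansion[of h] by (simp add: scalar_mult_eq_scaleR)
    also have "\<dots> = (\<Sum>i\<in>UNIV. h $ i *\<^sub>R partial i f x)"
      by (simp add: linear_sum[OF lin] linear_scale[OF lin] partial_def)
    finally show ?thesis .
  qed
  then have "?D = (\<lambda>h. \<Sum>i\<in>UNIV. h $ i *\<^sub>R partial i f x)" by blast
  with D show ?thesis by simp
qed

lemma sum_axis_scaleR: "(\<Sum>j\<in>UNIV. axis i 1 $ j *\<^sub>R g j) = (g (i::'n::finite) :: 'a::real_vector)"
proof -
  have "(\<Sum>j\<in>UNIV. axis i 1 $ j *\<^sub>R g j) = (\<Sum>j\<in>UNIV. if j = i then g j else 0)"
    by (intro sum.cong) (auto simp: axis_def)
  then show ?thesis by simp
qed

lemma C1_I: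
  assumes "\<And>x. (f has_derivative D x) (at x)"
    and "\<And>i. continuous_on UNIV (\<lambda>x. D x (axis i 1))"
  shows "C1 f"
proof -
  have "partial i f = (\<lambda>x. D x (axis i 1))" for i
    using partial_eqI[OF assms(1)] by blast
  then show ?thesis
    using assms by (auto simp: C1_def differentiable_def)
qed

lemma C1_has_derivative:
  "C1 f \<Longrightarrow> (f has_derivative (\<lambda>h. \<Sum>i\<in>UNIV. h $ i *\<^sub>R partial i f x)) (at x)"
  by (simp add: C1_def has_derivative_partials)

lemma C1_continuous_on: "C1 f \<Longrightarrow> continuous_on S f"
  by (intro continuous_at_imp_continuous_on ballI has_derivative_continuous[OF C1_has_derivative])

lemma C1_continuous_on_partial: "C1 f \<Longrightarrow> continuous_on S (partial i f)"
  using C1_def continuous_on_subset by blast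

lemma iter_partial_append: "iter_partial js (iter_partial ks f) = iter_partial (js @ ks) f"
  by (induction js) auto

lemma smooth_differentiable: "smooth f \<Longrightarrow> f differentiable (at x)"
  unfolding smooth_def by (drule spec[of _ "[]"]) simp

lemma smooth_partial: "smooth f \<Longrightarrow> smooth (partial i f)"
  unfolding smooth_def using iter_partial_append[of _ "[i]" f] by simp

text \<open>Iterated partial derivatives never leave \<open>S\<close>, so no formula for them has to
  be found; each application only exhibits a set of expressions that differentiation
  reproduces.\<close>

lemma smooth_coinduct:
  assumes "f \<in> S"
    and "\<And>g x. g \<in> S \<Longrightarrow> g differentiable (at x)"
    and "\<And>g i. g \<in> S \<Longrightarrow> partial i g \<in> S"
  shows "smooth f"
proof -
  have "iter_partial js f \<in> S" for js
    by (induction js) (use assms in auto)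
  then show ?thesis
    using assms by (auto simp: smooth_def)
qed

lemma smooth_C1: "smooth f \<Longrightarrow> C1 f"
  unfolding C1_def
  by (auto intro!: smooth_differentiable continuous_at_imp_continuous_on
      differentiable_imp_continuous_within dest: smooth_partial)

text \<open>The Leibniz rule turns one inner product into two, so single products are not stable
  under \<open>partial\<close>, while their finite sums are. This is the invariant for
  \<open>smooth_coinduct\<close>.\<close>

inductive inner_sum :: "(real^3 \<Rightarrow> real) \<Rightarrow> bool" where
  inner: "smooth f \<Longrightarrow> smooth g \<Longrightarrow> inner_sum (\<lambda>x. f x \<bullet> (g x :: real^3))"
| plus: "inner_sum a \<Longrightarrow> inner_sum b \<Longrightarrow> inner_sum (\<lambda>x. a x + b x)"

lemma inner_sum_partial:
  "inner_sum a \<Longrightarrow> (\<forall>x. a differentiable (at x)) \<and> (\<forall>i. inner_sum (partial i a))"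
proof (induction rule: inner_sum.induct)
  case (inner f g)
  have d: "((\<lambda>x. f x \<bullet> g x) has_derivative
      (\<lambda>h. f x \<bullet> (\<Sum>i\<in>UNIV. h $ i *\<^sub>R partial i g x) + (\<Sum>i\<in>UNIV. h $ i *\<^sub>R partial i f x) \<bullet> g x)) (at x)" for x
    by (intro has_derivative_inner C1_has_derivative smooth_C1 inner)
  have "partial i (\<lambda>x. f x \<bullet> g x) = (\<lambda>x. f x \<bullet> partial i g x + partial i f x \<bullet> g x)" for i
    by (rule ext, subst partial_eqI[OF d]) (simp only: sum_axis_scaleR)
  with d show ?case
    by (auto simp: differentiable_def intro!: inner_sum.intros smooth_partial inner)
next
  case (plus a b)
  have "partial i (\<lambda>x. a x + b x) = (\<lambda>x. partial i a x + partial i b x)" for i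
  proof
    fix x
    have "((\<lambda>x. a x + b x) has_derivative (\<lambda>h. (\<Sum>i\<in>UNIV. h $ i *\<^sub>R partial i a x) + (\<Sum>i\<in>UNIV. h $ i *\<^sub>R partial i b x))) (at x)"
      using plus by (intro has_derivative_add has_derivative_partials) auto
    from partial_eqI[OF this] show "partial i (\<lambda>x. a x + b x) x = partial i a x + partial i b x"
      by (simp only: sum_axis_scaleR)
  qed
  with plus show ?case
    by (auto intro!: inner_sum.intros derivative_intros)
qed

lemma smooth_inner:
  fixes f g :: "real^3 \<Rightarrow> real^3"
  assumes "smooth f" "smooth g"
  shows "smooth (\<lambda>x. f x \<bullet> g x)"
  by (rule smooth_coinduct[of _ "Collect inner_sum"])
     (use inner_sum_partial inner_sum.inner[OF assms] in auto)

lemma smooth_dilate: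
  fixes f :: "real^3 \<Rightarrow> 'a::real_normed_vector"
  assumes "smooth f"
  shows "smooth (\<lambda>x. f (k *\<^sub>R x))"
proof (rule smooth_coinduct)
  \<comment> \<open>The factor \<open>c\<close> collects the powers of \<open>k\<close> that the
    chain rule produces.\<close>
  let ?S = "{\<lambda>x. c *\<^sub>R g (k *\<^sub>R x) | c (g :: real^3 \<Rightarrow> 'a). smooth g}"
  show "(\<lambda>x. f (k *\<^sub>R x)) \<in> ?S"
    using assms by (intro CollectI exI[of _ 1] exI[of _ f]) auto
  have d: "((\<lambda>x. c *\<^sub>R g (k *\<^sub>R x)) has_derivative
      (\<lambda>h. c *\<^sub>R (\<Sum>i\<in>UNIV. (k *\<^sub>R h) $ i *\<^sub>R partial i g (k *\<^sub>R x)))) (at x)"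
    if "smooth g" for c x and g :: "real^3 \<Rightarrow> 'a"
    by (intro derivative_intros has_derivative_compose[of "\<lambda>x. k *\<^sub>R x" _ _ _ g]
        C1_has_derivative smooth_C1 that)
  show "g differentiable (at x)" if "g \<in> ?S" for g x
  proof -
    from that obtain c and q :: "real^3 \<Rightarrow> 'a" where q: "smooth q" "g = (\<lambda>x. c *\<^sub>R q (k *\<^sub>R x))"
      by blast
    show ?thesis
      unfolding q(2) differentiable_def by (rule exI, rule d[OF q(1)])
  qed
  show "partial i g \<in> ?S" if gS: "g \<in> ?S" for g i
  proof -
    obtain c q where q: "smooth q" "g = (\<lambda>x. c *\<^sub>R q (k *\<^sub>R x))"
      using gS by blast
    have "partial i g = (\<lambda>x. (c * k) *\<^sub>R partial i q (k *\<^sub>R x))"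
      unfolding q(2)
      by (rule ext, subst partial_eqI[OF d[OF q(1)]])
         (simp only: vector_scaleR_component scaleR_scaleR[symmetric] scaleR_sum_right[symmetric]
           sum_axis_scaleR real_scaleR_def)
    then show ?thesis
      using smooth_partial[OF q(1), of i]
      by (intro CollectI exI[of _ "c * k"] exI[of _ "partial i q"]) auto
  qed
qed

section \<open>Supports\<close>

lemma notin_supp: "x \<notin> supp f \<Longrightarrow> f x = 0"
  unfolding supp_def using closure_subset[of "{x. f x \<noteq> 0}"] by auto

lemma has_derivative_outside_supp:
  assumes "x \<notin> supp f"
  shows "(f has_derivative (\<lambda>h. 0)) (at x)"
proof -
  have "open (- supp f)"
    by (simp add: supp_def open_Compl)
  then have "eventually (\<lambda>y. y \<in> - supp f) (at x)"
    using assms by (intro eventually_at_in_open') auto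
  then have "eventually (\<lambda>y. 0 = f y) (at x)"
    by (rule eventually_mono) (simp add: notin_supp)
  then show ?thesis
    using assms notin_supp[OF assms]
    by (intro has_derivative_transform_eventually[OF has_derivative_const[of 0 "at x"]]) auto
qed

lemma partial_outside_supp: "x \<notin> supp f \<Longrightarrow> partial i f x = 0"
  by (rule partial_eqI[OF has_derivative_outside_supp])

lemma supp_subset:
  assumes "closed K" and "\<And>x. x \<notin> K \<Longrightarrow> f x = 0"
  shows "supp f \<subseteq> K"
  unfolding supp_def using assms by (intro closure_minimal) auto

lemma compact_supp:
  assumes "compact K" and "\<And>x. x \<notin> K \<Longrightarrow> f x = 0"
  shows "compact (supp f)"
proof -
  have "supp f \<subseteq> K"
    using supp_subset assms compact_imp_closed by blast
  moreover have "closed (supp f)"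
    by (simp add: supp_def)
  ultimately show ?thesis
    using assms(1) by (metis inf.absorb_iff2 compact_Int_closed)
qed

text \<open>\<open>leibniz_rule\<close> wants the derivative to be continuous as a bounded linear
  map. In finite dimension continuity on the basis vectors suffices, which is the form of
  \<open>cD\<close>.\<close>

lemma leibniz_has_derivative:
  fixes f :: "real^3 \<Rightarrow> 'b::euclidean_space \<Rightarrow> real"
  assumes d: "\<And>x t. t \<in> cbox a b \<Longrightarrow> ((\<lambda>x. f x t) has_derivative D x t) (at x)"
    and cf: "\<And>x. continuous_on (cbox a b) (f x)"
    and cD: "\<And>i. continuous_on (UNIV \<times> cbox a b) (\<lambda>(x, t). D x t (axis i 1))"
  shows "((\<lambda>x. integral (cbox a b) (f x)) has_derivative
           (\<lambda>h. integral (cbox a b) (\<lambda>t. D x t h))) (at x)"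
proof -
  define B where "B = (\<lambda>x t. Blinfun (D x t))"
  have B: "blinfun_apply (B x t) = D x t" if "t \<in> cbox a b" for x t
    unfolding B_def using d[OF that] by (intro bounded_linear_Blinfun_apply has_derivative_bounded_linear)
  have cB: "continuous_on (UNIV \<times> cbox a b) (\<lambda>(x, t). B x t)"
  proof (rule continuous_on_blinfun_componentwise)
    fix j :: "real^3"
    assume "j \<in> Basis"
    then obtain i where "j = axis i 1"
      by (auto simp: Basis_vec_def)
    then show "continuous_on (UNIV \<times> cbox a b) (\<lambda>z. blinfun_apply (case z of (x, t) \<Rightarrow> B x t) j)"
      using cD[of i] by (rule_tac continuous_on_eq[of _ "\<lambda>(x, t). D x t (axis i 1)"]) (auto simp: B)
  qed
  have "((\<lambda>x. integral (cbox a b) (f x)) has_derivative integral (cbox a b) (B x)) (at x within UNIV)"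
    by (rule leibniz_rule[OF _ _ cB])
       (auto simp: B intro!: d integrable_continuous cf)
  moreover have "blinfun_apply (integral (cbox a b) (B x)) = (\<lambda>h. integral (cbox a b) (\<lambda>t. D x t h))"
  proof
    fix h
    have "continuous_on (cbox a b) (B x)"
      using continuous_on_compose2[OF cB, of "cbox a b" "\<lambda>t. (x, t)"]
      by (auto simp: continuous_on_Pair)
    then have "B x integrable_on cbox a b"
      by (rule integrable_continuous)
    then have "blinfun_apply (integral (cbox a b) (B x)) h = integral (cbox a b) (\<lambda>t. B x t h)"
      using integral_linear[of "B x" "cbox a b" "\<lambda>F. blinfun_apply F h"]
      by (simp add: o_def blinfun.bounded_linear_left)
    also have "\<dots> = integral (cbox a b) (\<lambda>t. D x t h)"
      by (intro integral_cong) (simp add: B)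
    finally show "blinfun_apply (integral (cbox a b) (B x)) h = integral (cbox a b) (\<lambda>t. D x t h)" .
  qed
  ultimately show ?thesis by simp
qed

lemma leibniz_C1:
  fixes f :: "real^3 \<Rightarrow> 'b::euclidean_space \<Rightarrow> real"
  assumes "\<And>x t. t \<in> cbox a b \<Longrightarrow> ((\<lambda>x. f x t) has_derivative D x t) (at x)"
    and "\<And>x. continuous_on (cbox a b) (f x)"
    and cD: "\<And>i. continuous_on (UNIV \<times> cbox a b) (\<lambda>(x, t). D x t (axis i 1))"
  shows "C1 (\<lambda>x. integral (cbox a b) (f x))"
    and "partial i (\<lambda>x. integral (cbox a b) (f x)) x = integral (cbox a b) (\<lambda>t. D x t (axis i 1))"
proof -
  have 1: "((\<lambda>x. integral (cbox a b) (f x)) has_derivative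
           (\<lambda>h. integral (cbox a b) (\<lambda>t. D x t h))) (at x)" for x
    by (rule leibniz_has_derivative[OF assms])
  show "C1 (\<lambda>x. integral (cbox a b) (f x))"
    by (rule C1_I[OF 1 integral_continuous_on_param[OF cD]])
  show "partial i (\<lambda>x. integral (cbox a b) (f x)) x = integral (cbox a b) (\<lambda>t. D x t (axis i 1))"
    by (rule partial_eqI[OF 1])
qed

section \<open>Testing the divergence against \<open>C\<^sup>1\<close> functions\<close>

lemma integral_eq_integral_UNIV:
  fixes f :: "'a::euclidean_space \<Rightarrow> 'b::banach"
  assumes "\<And>x. x \<notin> S \<Longrightarrow> f x = 0"
  shows "integral S f = integral UNIV f"
proof -
  have "f = (\<lambda>x. if x \<in> S then f x else 0)"
    using assms by auto
  then show ?thesis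
    by (metis integral_restrict_UNIV)
qed

text \<open>Substitution z = x - y. Mollification uses both forms: with the derivatives on
  \<open>q\<close> the convolution is smooth, with the derivatives on \<open>p\<close> its partials
  approximate those of \<open>p\<close>.\<close>

lemma convolution_commute:
  fixes p q :: "'a::euclidean_space \<Rightarrow> real"
  assumes p: "\<And>y. y \<notin> cbox a b \<Longrightarrow> p y = 0" and q: "\<And>y. y \<notin> cbox c d \<Longrightarrow> q y = 0"
  shows "integral (cbox a b) (\<lambda>y. p y * q (x - y)) = integral (cbox c d) (\<lambda>z. p (x - z) * q z)"
proof -
  let ?F = "\<lambda>y. p y * q (x - y)"
  have "integral (cbox a b) ?F = integral (cbox (-b) (-a)) (\<lambda>z. ?F (-z))"
    by (rule integral_reflect[symmetric])
  also have "\<dots> = integral (cbox (-b - (-x)) (-a - (-x))) (\<lambda>z. ?F (- (z + - x)))"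
    by (rule integral_shift_cbox[symmetric])
  also have "\<dots> = integral (cbox (x - b) (x - a)) (\<lambda>z. p (x - z) * q z)"
    by (simp add: algebra_simps)
  also have "\<dots> = integral UNIV (\<lambda>z. p (x - z) * q z)"
  proof (rule integral_eq_integral_UNIV)
    fix z assume "z \<notin> cbox (x - b) (x - a)"
    then have "x - z \<notin> cbox a b"
      by (auto simp: mem_box algebra_simps)
    then show "p (x - z) * q z = 0"
      by (simp add: p)
  qed
  also have "\<dots> = integral (cbox c d) (\<lambda>z. p (x - z) * q z)"
    by (rule integral_eq_integral_UNIV[symmetric]) (simp add: q)
  finally show ?thesis .
qed

lemma smooth_convolution:
  fixes p q :: "real^3 \<Rightarrow> real"
  assumes p: "continuous_on UNIV p" and "smooth q"
  shows "smooth (\<lambda>x. integral (cbox a b) (\<lambda>y. p y * q (x - y)))"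
proof -
  let ?S = "{\<lambda>x. integral (cbox a b) (\<lambda>y. p y * q (x - y)) | q. smooth q}"
  have cq: "continuous_on UNIV q" if "smooth q" for q :: "real^3 \<Rightarrow> real"
    using that smooth_C1 C1_continuous_on by blast
  let ?D = "\<lambda>q x y h. p y * (\<Sum>i\<in>UNIV. h $ i *\<^sub>R partial i q (x - y))"
  have d: "((\<lambda>x. p y * q (x - y)) has_derivative ?D q x y) (at x)"
    if "smooth q" for q :: "real^3 \<Rightarrow> real" and x y
    by (intro has_derivative_mult_right has_derivative_compose[of "\<lambda>x. x - y" "\<lambda>h. h" _ _ q] derivative_eq_intros
         C1_has_derivative smooth_C1 that refl) auto
  have cc: "continuous_on (cbox a b) (\<lambda>y. p y * q (x - y))" if "smooth q" for q :: "real^3 \<Rightarrow> real" and x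
    by (intro continuous_intros continuous_on_compose2[OF cq[OF that]] continuous_on_subset[OF p]) auto
  have cD: "continuous_on (UNIV \<times> cbox a b) (\<lambda>(x, y). ?D q x y (axis i 1))"
    if "smooth q" for q :: "real^3 \<Rightarrow> real" and i
    unfolding sum_axis_scaleR case_prod_unfold
    by (intro continuous_intros continuous_on_compose2[OF cq[OF smooth_partial[OF that]]]
         continuous_on_compose2[OF p]) auto
  show ?thesis
  proof (rule smooth_coinduct[of _ ?S])
    show "(\<lambda>x. integral (cbox a b) (\<lambda>y. p y * q (x - y))) \<in> ?S"
      using assms by (intro CollectI exI[of _ q]) auto
    show "g differentiable (at x)" if "g \<in> ?S" for g x
    proof -
      from that obtain q where q: "smooth q" "g = (\<lambda>x. integral (cbox a b) (\<lambda>y. p y * q (x - y)))"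
        by blast
      show ?thesis
        unfolding q(2) differentiable_def
        by (rule exI, rule leibniz_has_derivative[OF d[OF q(1)] cc[OF q(1)] cD[OF q(1)]])
    qed
    show "partial i g \<in> ?S" if "g \<in> ?S" for g i
    proof -
      from that obtain q where q: "smooth q" "g = (\<lambda>x. integral (cbox a b) (\<lambda>y. p y * q (x - y)))"
        by blast
      have "partial i g = (\<lambda>x. integral (cbox a b) (\<lambda>y. p y * partial i q (x - y)))"
        unfolding q(2) using leibniz_C1(2)[OF d[OF q(1)] cc[OF q(1)] cD[OF q(1)], where i=i]
        unfolding sum_axis_scaleR by (rule ext)
      then show ?thesis
        using smooth_partial[OF q(1), of i] by (intro CollectI exI[of _ "partial i q"]) auto
    qed
  qed
qed

lemma compact_support_uniformly_continuous:
  fixes f :: "'a::euclidean_space \<Rightarrow> 'b::metric_space"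
  assumes f: "continuous_on UNIV f" and K: "compact K" and z: "\<And>x. x \<notin> K \<Longrightarrow> f x = z" and "e > 0"
  obtains d where "d > 0" "\<And>x y. dist x y < d \<Longrightarrow> dist (f x) (f y) < e"
proof -
  \<comment> \<open>The unit neighbourhood of \<open>K\<close> contains both points as soon as one
    of them is in \<open>K\<close> and their distance is below 1; this explains the minimum with 1
    below.\<close>
  define K' where "K' = {x + y | x y. x \<in> K \<and> y \<in> cball 0 1}"
  have "compact K'"
    unfolding K'_def by (intro compact_sums K compact_cball)
  then have "uniformly_continuous_on K' f"
    by (intro compact_uniformly_continuous continuous_on_subset[OF f]) auto
  from uniformly_continuous_onE[OF this \<open>e > 0\<close>]
  obtain d where d: "d > 0" "\<And>x y. x \<in> K' \<Longrightarrow> y \<in> K' \<Longrightarrow> dist y x < d \<Longrightarrow> dist (f y) (f x) < e"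
    by blast
  have *: "dist (f x) (f y) < e" if "x \<in> K" "dist x y < min d 1" for x y
  proof -
    have "x \<in> K'"
      using that unfolding K'_def by (intro CollectI exI[of _ x] exI[of _ 0]) auto
    moreover have "y \<in> K'"
      using that unfolding K'_def by (intro CollectI exI[of _ x] exI[of _ "y - x"]) (auto simp: dist_norm norm_minus_commute)
    ultimately show ?thesis
      using d(2)[of y x] that(2) by simp
  qed
  show ?thesis
  proof (rule that[of "min d 1"])
    fix x y :: 'a assume "dist x y < min d 1"
    then show "dist (f x) (f y) < e"
      using *[of x y] *[of y x] z[of x] z[of y] \<open>e > 0\<close>
      by (cases "x \<in> K"; cases "y \<in> K") (auto simp: dist_commute)
  qed (use d in auto)
qed

lemma bounded_open_lmeasurable: "bounded \<Omega> \<Longrightarrow> open \<Omega> \<Longrightarrow> \<Omega> \<in> lmeasurable"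
  by (simp add: lmeasurable_open)

lemma continuous_bounded_on_bounded:
  fixes F :: "'a::euclidean_space \<Rightarrow> 'b::real_normed_vector"
  assumes "bounded \<Omega>" "continuous_on UNIV F"
  obtains B where "B > 0" "\<And>x. x \<in> \<Omega> \<Longrightarrow> norm (F x) \<le> B"
proof -
  have "compact (F ` closure \<Omega>)"
    using assms by (intro compact_continuous_image continuous_on_subset[OF assms(2)]) auto
  then obtain B where "B > 0" "\<forall>x\<in>F ` closure \<Omega>. norm x \<le> B"
    using bounded_pos compact_imp_bounded by blast
  then show ?thesis
    using that[of B] closure_subset[of \<Omega>] by auto
qed

lemma continuous_lebesgue_on_measurable:
  fixes F :: "'a::euclidean_space \<Rightarrow> 'b::{second_countable_topology, real_normed_vector}"
  assumes "continuous_on UNIV F"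
  shows "F \<in> borel_measurable (lebesgue_on \<Omega>)"
proof -
  have "F \<in> borel_measurable borel"
    using assms by (rule borel_measurable_continuous_onI)
  then have "F \<in> borel_measurable lebesgue"
    by (simp add: measurable_completion)
  then show ?thesis
    by (rule measurable_restrict_space1)
qed

lemma L2_integrable_norm:
  assumes "bounded \<Omega>" "open \<Omega>" "E \<in> L2 \<Omega>"
  shows "integrable (lebesgue_on \<Omega>) (\<lambda>x. norm (E x))"
proof -
  interpret finite_measure "lebesgue_on \<Omega>"
    using assms by (intro finite_measure_lebesgue_on bounded_open_lmeasurable)
  have [measurable]: "E \<in> borel_measurable (lebesgue_on \<Omega>)"
    and 2: "integrable (lebesgue_on \<Omega>) (\<lambda>x. (norm (E x))\<^sup>2)"
    using assms by (simp_all add: L2_def)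
  have "(\<lambda>x. norm (E x)) \<in> borel_measurable (lebesgue_on \<Omega>)"
    by measurable
  then show ?thesis
    using 2 by (rule square_integrable_imp_integrable)
qed

lemma integrable_inner_continuous:
  fixes F :: "real^3 \<Rightarrow> real^3"
  assumes "bounded \<Omega>" "open \<Omega>" "E \<in> L2 \<Omega>" and F: "continuous_on UNIV F"
  shows "integrable (lebesgue_on \<Omega>) (\<lambda>x. E x \<bullet> F x)"
proof -
  have [measurable]: "E \<in> borel_measurable (lebesgue_on \<Omega>)"
    using assms by (simp add: L2_def)
  have [measurable]: "F \<in> borel_measurable (lebesgue_on \<Omega>)"
    by (rule continuous_lebesgue_on_measurable[OF F])
  obtain B where B: "B > 0" "\<And>x. x \<in> \<Omega> \<Longrightarrow> norm (F x) \<le> B"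
    using continuous_bounded_on_bounded[OF \<open>bounded \<Omega>\<close> F] by metis
  show ?thesis
  proof (rule Bochner_Integration.integrable_bound)
    show "integrable (lebesgue_on \<Omega>) (\<lambda>x. norm (E x) * B)"
      using L2_integrable_norm assms by auto
    show "AE x in lebesgue_on \<Omega>. norm (E x \<bullet> F x) \<le> norm (norm (E x) * B)"
    proof (rule AE_I2)
      fix x assume "x \<in> space (lebesgue_on \<Omega>)"
      then have "norm (E x \<bullet> F x) \<le> norm (E x) * norm (F x)" "norm (F x) \<le> B"
        using Cauchy_Schwarz_ineq2 B by (auto simp: space_restrict_space)
      then show "norm (E x \<bullet> F x) \<le> norm (norm (E x) * B)"
        using B(1) mult_left_mono[of "norm (F x)" B "norm (E x)"] by simp
    qed
  qed auto
qed

lemma continuous_on_grad: "C1 \<psi> \<Longrightarrow> continuous_on S (grad \<psi>)"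
  unfolding grad_def by (intro continuous_on_vec_lambda C1_continuous_on_partial)

text \<open>Mollification of \<psi>. The potentials of the homotopy formula are only
  \<open>C1\<close>, whereas \<open>weak_div_free\<close> speaks of smooth functions. The bump
  \<open>r\<close> is a parameter because a nonzero test field \<open>F\<close> provides one, namely
  the square of its norm.\<close>

lemma weak_div_free_C1:
  fixes r \<psi> :: "real^3 \<Rightarrow> real"
  assumes \<Omega>: "bounded \<Omega>" "open \<Omega>" and E: "E \<in> L2 \<Omega>" "weak_div_free \<Omega> E"
    and r: "smooth r" "compact (supp r)" "\<And>x. r x \<ge> 0" "r x0 \<noteq> 0"
    and \<psi>: "C1 \<psi>" "compact (supp \<psi>)" "supp \<psi> \<subseteq> \<Omega>"
  shows "(\<integral>x. E x \<bullet> grad \<psi> x \<partial>lebesgue_on \<Omega>) = 0"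
proof -
  let ?M = "lebesgue_on \<Omega>"
  define A where "A = (\<integral>x. norm (E x) \<partial>?M)"
  have intE: "integrable ?M (\<lambda>x. norm (E x))"
    using L2_integrable_norm \<Omega> E by blast
  obtain R where R: "R > 0" "\<And>x. x \<in> supp r \<Longrightarrow> norm x \<le> R"
    using r(2) by (meson bounded_pos compact_imp_bounded)
  obtain d0 where d0: "d0 > 0" "(\<Union>x\<in>supp \<psi>. ball x d0) \<subseteq> \<Omega>"
    using compact_subset_open_imp_ball_epsilon_subset[OF \<psi>(2) \<Omega>(2) \<psi>(3)] by blast
  obtain a b where ab: "supp \<psi> \<subseteq> cbox a b"
    using \<psi>(2) by (meson bounded_subset_cbox_symmetric compact_imp_bounded)
  have c\<psi>: "continuous_on UNIV \<psi>" "\<And>i. continuous_on UNIV (partial i \<psi>)" "continuous_on UNIV (grad \<psi>)"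
    using \<psi>(1) by (auto intro: C1_continuous_on C1_continuous_on_partial continuous_on_grad)
  \<comment> \<open>The factor 3 counts coordinates: the norm of the error in the gradient is
    bounded by the sum of three partial errors, each at most \<open>e\<close> times the mass of the
    mollifier.\<close>
  have "\<bar>\<integral>x. E x \<bullet> grad \<psi> x \<partial>?M\<bar> \<le> A * (3 * e)" if "e > 0" for e
  proof -
    have "grad \<psi> x = 0" if "x \<notin> supp \<psi>" for x
      using that by (simp add: grad_def partial_outside_supp vec_eq_iff)
    then obtain d1 where d1: "d1 > 0" "\<And>x y. dist x y < d1 \<Longrightarrow> dist (grad \<psi> x) (grad \<psi> y) < e"
      using compact_support_uniformly_continuous[OF c\<psi>(3) \<psi>(2) _ \<open>e > 0\<close>] by metis
    \<comment> \<open>The kernel then lives in a ball of radius \<open>R * \<delta>\<close>, below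
      \<open>d0\<close> to keep the support in \<Omega> and below \<open>d1\<close> to use uniform
      continuity of the gradient.\<close>
    define \<delta> where "\<delta> = min d0 d1 / (2 * R)"
    have \<delta>: "\<delta> > 0" "R * \<delta> < d0" "R * \<delta> < d1"
      using d0 d1 R by (auto simp: \<delta>_def)
    define q where "q = (\<lambda>z. r ((1 / \<delta>) *\<^sub>R z))"
    have qs: "smooth q"
      unfolding q_def by (rule smooth_dilate[OF r(1)])
    have cq: "continuous_on S q" for S
      using qs smooth_C1 C1_continuous_on by blast
    have q0: "norm z \<le> R * \<delta>" if "q z \<noteq> 0" for z
    proof -
      have "(1 / \<delta>) *\<^sub>R z \<in> supp r"
        using that notin_supp unfolding q_def by metis
      then have "norm ((1 / \<delta>) *\<^sub>R z) \<le> R"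
        by (rule R)
      then show ?thesis
        using \<delta> by (simp add: field_simps)
    qed
    \<comment> \<open>The point \<open>\<delta> *\<^sub>R x0\<close>, where \<open>q\<close> does
      not vanish, is placed in the open box so that the box is nondegenerate and the mass
      \<open>M\<close> is nonzero. The kernel is not normalised; \<open>M\<close> is divided out at
      the end.\<close>
    obtain c d where cd: "cball 0 (R * \<delta>) \<union> {\<delta> *\<^sub>R x0} \<subseteq> box c d"
      by (meson bounded_Un bounded_cball bounded_subset_box_symmetric finite.intros finite_imp_bounded)
    then have cd': "cball 0 (R * \<delta>) \<subseteq> cbox c d" "\<delta> *\<^sub>R x0 \<in> box c d"
      using box_subset_cbox by blast+
    have qcd: "q z = 0" if "z \<notin> cbox c d" for z
      using that cd' q0 by (metis mem_cball_0 subsetD)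
    define M where "M = integral (cbox c d) q"
    have "M \<ge> 0"
      unfolding M_def using r(3) by (intro integral_nonneg integrable_continuous cq) (auto simp: q_def)
    moreover have "M \<noteq> 0"
    proof
      assume "M = 0"
      then have "(q has_integral 0) (cbox c d)"
        unfolding M_def by (metis cq integrable_continuous integrable_integral)
      then have "q (\<delta> *\<^sub>R x0) = 0"
        using cd'(2) r(3) box_subset_cbox[of c d]
        by (intro has_integral_0_cbox_imp_0[OF cq[of "cbox c d"]]) (auto simp: q_def)
      then show False
        using r(4) \<delta> by (simp add: q_def)
    qed
    ultimately have "M > 0" by simp
    define \<phi> where "\<phi> = (\<lambda>x. integral (cbox a b) (\<lambda>y. \<psi> y * q (x - y)))"
    have \<phi>s: "smooth \<phi>"
      unfolding \<phi>_def by (intro smooth_convolution c\<psi> qs)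
    have \<psi>ab: "\<psi> y = 0" if "y \<notin> cbox a b" for y
      using that ab notin_supp by blast
    have \<phi>_alt: "\<phi> = (\<lambda>x. integral (cbox c d) (\<lambda>z. \<psi> (x - z) * q z))"
      unfolding \<phi>_def by (intro ext convolution_commute \<psi>ab qcd)
    have der: "partial i \<phi> x = integral (cbox c d) (\<lambda>z. partial i \<psi> (x - z) * q z)" for i x
    proof -
      let ?D = "\<lambda>x z h. (\<Sum>i\<in>UNIV. h $ i *\<^sub>R partial i \<psi> (x - z)) * q z"
      have "((\<lambda>x. \<psi> (x - z) * q z) has_derivative ?D x z) (at x)" for x z
        by (intro has_derivative_mult_left has_derivative_compose[of "\<lambda>x. x - z" "\<lambda>h. h" _ _ \<psi>] derivative_eq_intros
            C1_has_derivative \<psi>(1) refl) auto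
      moreover have "continuous_on (cbox c d) (\<lambda>z. \<psi> (x - z) * q z)" for x
        by (intro continuous_intros continuous_on_compose2[OF c\<psi>(1)] cq) auto
      moreover have "continuous_on (UNIV \<times> cbox c d) (\<lambda>(x, z). ?D x z (axis i 1))" for i
        unfolding sum_axis_scaleR case_prod_unfold
        by (intro continuous_intros continuous_on_compose2[OF c\<psi>(2)]
             continuous_on_compose2[OF cq[of UNIV]]) auto
      ultimately have "partial i (\<lambda>x. integral (cbox c d) (\<lambda>z. \<psi> (x - z) * q z)) x
          = integral (cbox c d) (\<lambda>z. ?D x z (axis i 1))"
        by (rule leibniz_C1(2))
      then show ?thesis
        unfolding \<phi>_alt sum_axis_scaleR .
    qed
    have near: "\<bar>partial i \<phi> x - M * partial i \<psi> x\<bar> \<le> e * M" for i x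
    proof -
      have i1: "(\<lambda>z. partial i \<psi> (x - z) * q z) integrable_on cbox c d"
        by (intro integrable_continuous continuous_intros continuous_on_compose2[OF c\<psi>(2)] cq) auto
      have i2: "(\<lambda>z. k * q z) integrable_on cbox c d" for k
        by (intro integrable_continuous continuous_intros cq)
      have "partial i \<phi> x - M * partial i \<psi> x
          = integral (cbox c d) (\<lambda>z. partial i \<psi> (x - z) * q z - partial i \<psi> x * q z)"
        unfolding der M_def by (subst integral_diff[OF i1 i2]) (simp add: mult.commute)
      also have "norm \<dots> \<le> integral (cbox c d) (\<lambda>z. e * q z)"
      proof (rule integral_norm_bound_integral)
        fix z
        show "norm (partial i \<psi> (x - z) * q z - partial i \<psi> x * q z) \<le> e * q z"
        proof (cases "q z = 0")
          case False
          then have "dist (x - z) x < d1"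
            using q0 \<delta> by (force simp: dist_norm)
          then have "norm (grad \<psi> (x - z) - grad \<psi> x) < e"
            using d1 by (simp add: dist_norm)
          then have "\<bar>partial i \<psi> (x - z) - partial i \<psi> x\<bar> \<le> e"
            using component_le_norm_cart[of "grad \<psi> (x - z) - grad \<psi> x" i] by (simp add: grad_def)
          moreover have "q z \<ge> 0"
            using r(3) by (simp add: q_def)
          ultimately show ?thesis
            by (simp add: left_diff_distrib[symmetric] abs_mult mult_right_mono)
        qed simp
      qed (intro integrable_diff i1 i2)+
      also have "\<dots> = e * M"
        by (simp add: M_def)
      finally show ?thesis by simp
    qed
    have "\<phi> \<in> test_fun \<Omega>"
    proof -
      let ?K = "{y + z | y z. y \<in> supp \<psi> \<and> z \<in> cball 0 (R * \<delta>)}"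
      have K: "compact ?K"
        by (intro compact_sums \<psi>(2) compact_cball)
      have "\<phi> x = 0" if "x \<notin> ?K" for x
      proof -
        have "\<psi> y * q (x - y) = 0" for y
        proof (rule ccontr)
          assume "\<psi> y * q (x - y) \<noteq> 0"
          then have "y \<in> supp \<psi>" "norm (x - y) \<le> R * \<delta>"
            using notin_supp q0 by auto
          then have "x \<in> ?K"
            by (intro CollectI exI[of _ y] exI[of _ "x - y"]) auto
          with that show False by contradiction
        qed
        then show ?thesis
          unfolding \<phi>_def by (simp only: integral_0)
      qed
      then have "supp \<phi> \<subseteq> ?K" "compact (supp \<phi>)"
        using supp_subset compact_supp K compact_imp_closed by blast+
      moreover have "?K \<subseteq> \<Omega>"
      proof clarify
        fix y z :: "real^3" assume "y \<in> supp \<psi>" "z \<in> cball 0 (R * \<delta>)"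
        then have "y + z \<in> ball y d0"
          using \<delta> by (simp add: dist_norm)
        then show "y + z \<in> \<Omega>"
          using d0 \<open>y \<in> supp \<psi>\<close> by blast
      qed
      ultimately show ?thesis
        using \<phi>s by (auto simp: test_fun_def)
    qed
    then have zero: "(\<integral>x. E x \<bullet> grad \<phi> x \<partial>?M) = 0"
      using E(2) by (simp add: weak_div_free_def)
    have c\<phi>: "continuous_on UNIV (grad \<phi>)"
      using \<phi>s by (intro continuous_on_grad smooth_C1)
    have I1: "integrable ?M (\<lambda>x. E x \<bullet> grad \<phi> x)" and I2: "integrable ?M (\<lambda>x. E x \<bullet> grad \<psi> x)"
      using integrable_inner_continuous[OF \<Omega> E(1)] c\<phi> c\<psi> by auto
    have "M * \<bar>\<integral>x. E x \<bullet> grad \<psi> x \<partial>?M\<bar> = \<bar>\<integral>x. M * (E x \<bullet> grad \<psi> x) - E x \<bullet> grad \<phi> x \<partial>?M\<bar>"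
      using I1 I2 zero \<open>M > 0\<close> by (simp add: abs_mult)
    also have "\<dots> \<le> (\<integral>x. norm (E x) * (3 * e * M) \<partial>?M)"
    proof -
      have "norm (M * (E x \<bullet> grad \<psi> x) - E x \<bullet> grad \<phi> x) \<le> norm (E x) * (3 * e * M)" for x
      proof -
        have "norm (M *\<^sub>R grad \<psi> x - grad \<phi> x) \<le> (\<Sum>i\<in>UNIV. \<bar>(M *\<^sub>R grad \<psi> x - grad \<phi> x) $ i\<bar>)"
          by (rule norm_le_l1_cart)
        also have "\<dots> \<le> (\<Sum>i\<in>(UNIV::3 set). e * M)"
          using near by (intro sum_mono) (simp add: grad_def abs_minus_commute)
        finally have *: "norm (M *\<^sub>R grad \<psi> x - grad \<phi> x) \<le> 3 * e * M"
          by simp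
        have "M * (E x \<bullet> grad \<psi> x) - E x \<bullet> grad \<phi> x = E x \<bullet> (M *\<^sub>R grad \<psi> x - grad \<phi> x)"
          by (simp add: inner_diff_right)
        then have "norm (M * (E x \<bullet> grad \<psi> x) - E x \<bullet> grad \<phi> x) \<le> norm (E x) * norm (M *\<^sub>R grad \<psi> x - grad \<phi> x)"
          using Cauchy_Schwarz_ineq2 by simp
        also have "\<dots> \<le> norm (E x) * (3 * e * M)"
          using * by (intro mult_left_mono) auto
        finally show ?thesis .
      qed
      then show ?thesis
        using I1 I2 intE
        by (intro order_trans[OF integral_abs_bound] integral_mono) auto
    qed
    also have "\<dots> = M * (A * (3 * e))"
      by (simp add: A_def)
    finally show ?thesis
      using \<open>M > 0\<close> by simp
  qed
  note bnd = this
  have "\<bar>\<integral>x. E x \<bullet> grad \<psi> x \<partial>?M\<bar> \<le> 0"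
  proof (rule field_le_epsilon)
    fix e :: real assume "e > 0"
    have "A \<ge> 0"
      by (simp add: A_def)
    then have "A * (3 * (e / (3 * (A + 1)))) \<le> e"
      using \<open>e > 0\<close> by (simp add: field_simps)
    then show "\<bar>\<integral>x. E x \<bullet> grad \<psi> x \<partial>?M\<bar> \<le> 0 + e"
      using bnd[of "e / (3 * (A + 1))"] \<open>e > 0\<close> \<open>A \<ge> 0\<close> by simp
  qed
  then show ?thesis by simp
qed

section \<open>Dilations of a long convex set\<close>

text \<open>A truncated square is only \<open>C1\<close>, which is all that the dilations and the
  fields in \<open>perimeter\<close> require. It gives both the end correction \<open>v\<close> and
  the cut-off in \<open>perimeter_ge\<close>.\<close>

definition posq :: "real \<Rightarrow> real" where
  "posq t = (max 0 t)\<^sup>2"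

lemma posq_nonneg [simp]: "posq t \<ge> 0"
  by (simp add: posq_def)

lemma posq_nonpos: "t \<le> 0 \<Longrightarrow> posq t = 0"
  by (simp add: posq_def)

lemma posq_derivative: "(posq has_real_derivative 2 * max 0 t) (at t)"
proof (cases t "0::real" rule: linorder_cases)
  case less
  have "((\<lambda>_. 0) has_real_derivative 2 * max 0 t) (at t)"
    using less by simp
  then show ?thesis
    by (rule has_field_derivative_transform_within_open[of _ _ _ "{..<0}"])
       (use less in \<open>auto simp: posq_def\<close>)
next
  case greater
  have "((\<lambda>t. t\<^sup>2) has_real_derivative 2 * max 0 t) (at t)"
    using greater by (auto intro!: derivative_eq_intros)
  then show ?thesis
    by (rule has_field_derivative_transform_within_open[of _ _ _ "{0<..}"])
       (use greater in \<open>auto simp: posq_def\<close>)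
next
  case equal
  have "((\<lambda>h. (posq (0 + h) - posq 0) / h) \<longlongrightarrow> 0) (at 0)"
  proof (rule Lim_null_comparison)
    show "\<forall>\<^sub>F h in at 0. norm ((posq (0 + h) - posq 0) / h) \<le> \<bar>h\<bar>"
      by (rule always_eventually) (auto simp: posq_def max_def power2_eq_square)
    show "((\<lambda>h::real. \<bar>h\<bar>) \<longlongrightarrow> 0) (at 0)"
      by (rule tendsto_rabs_zero) (rule tendsto_ident_at)
  qed
  then show ?thesis
    using equal by (simp add: DERIV_def)
qed

lemma posq_has_derivative:
  assumes "(f has_derivative f') (at x)"
  shows "((\<lambda>x. posq (f x)) has_derivative (\<lambda>v. 2 * max 0 (f x) * f' v)) (at x)"
proof -
  have "(posq has_derivative (\<lambda>t. 2 * max 0 (f x) * t)) (at (f x))"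
    using posq_derivative[of "f x"] by (simp add: has_field_derivative_def)
  from has_derivative_compose[OF assms this] show ?thesis .
qed

lemma continuous_on_posq [continuous_intros]:
  "continuous_on S f \<Longrightarrow> continuous_on S (\<lambda>x. posq (f x))"
  unfolding posq_def by (intro continuous_intros)

text \<open>The same \<open>h\<close> is the height of a triangle in the closure
  (\<open>R_in\<close>) and a bound on the distance of all of \<Omega> from its base line
  (\<open>width_bound\<close>). The first controls the perimeter from below, the second the
  displacements from above.\<close>

locale thin_frame =
  fixes \<Omega> :: "(real^3) set" and P e1 e2 :: "real^3" and L h :: real
  assumes bounded_\<Omega>: "bounded \<Omega>" and open_\<Omega>: "open \<Omega>" and convex_\<Omega>: "convex \<Omega>"
    and unit: "e1 \<bullet> e1 = 1" "e2 \<bullet> e2 = 1" "e1 \<bullet> e2 = 0"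
    and h_pos: "0 < h" and h_le: "h \<le> L"
    and P_in: "P \<in> closure \<Omega>" and Q_in: "P + L *\<^sub>R e1 \<in> closure \<Omega>"
    and R_in: "\<exists>r. 0 \<le> r \<and> r \<le> L \<and> P + r *\<^sub>R e1 + h *\<^sub>R e2 \<in> closure \<Omega>"
    and length_bound: "\<And>x. x \<in> \<Omega> \<Longrightarrow> 0 < (x - P) \<bullet> e1 \<and> (x - P) \<bullet> e1 < L"
    and width_bound: "\<And>x. x \<in> \<Omega> \<Longrightarrow> norm (x - P - ((x - P) \<bullet> e1) *\<^sub>R e1) \<le> h"
begin

text \<open>
  \<open>V s x\<close> is the vector from the centre assigned to \<open>x\<close> to \<open>x\<close>, and \<open>g s t\<close> dilates by
  \<open>t\<close> from that centre. The centre has height \<open>s\<close> along \<open>e2\<close> and abscissa \<open>u - v u\<close> along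
  \<open>e1\<close>, where \<open>u\<close> is the abscissa of \<open>x\<close>; \<open>v\<close> is a \<open>C\<^sup>1\<close> correction that vanishes except
  within \<open>m\<close> of the two ends and keeps the centres away from the ends, where the slices of \<open>\<Omega>\<close>
  may degenerate. \<open>\<eta>\<close> is the derivative of \<open>v\<close>.
\<close>

definition "m = h / 2"
definition "\<sigma> = h\<^sup>2 / (4 * L)"
definition "v u = (posq (u - (L - m)) - posq (m - u)) / (2 * m)"
definition "\<eta> u = (max 0 (u - (L - m)) + max 0 (m - u)) / m"
definition "V s x = x - P - ((x - P) \<bullet> e1) *\<^sub>R e1 - s *\<^sub>R e2 + v ((x - P) \<bullet> e1) *\<^sub>R e1"
definition "DV x a = a - (a \<bullet> e1) *\<^sub>R e1 + (\<eta> ((x - P) \<bullet> e1) * (a \<bullet> e1)) *\<^sub>R e1"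
definition "g s t x = x + (t - 1) *\<^sub>R V s x"
definition "Dg t x a = a + (t - 1) *\<^sub>R DV x a"
text \<open>Eigenvalue of \<open>Dg t x\<close> along \<open>e1\<close>; on the plane orthogonal to
  \<open>e1\<close> the map is multiplication by \<open>t\<close>. Hence the determinant
  \<open>t\<^sup>2 * \<mu> t x\<close>, and the norm bound \<open>t\<close> for
  \<open>t \<ge> 1\<close> wherever \<eta> is at most 1.\<close>

definition "\<mu> t x = 1 + (t - 1) * \<eta> ((x - P) \<bullet> e1)"

lemma L_pos: "0 < L"
  using h_pos h_le by simp

lemma m_bounds: "0 < m" "2 * m \<le> L"
  using h_pos h_le by (auto simp: m_def)

lemma \<sigma>_bounds: "0 < \<sigma>" "\<sigma> \<le> h"
proof -
  show "0 < \<sigma>"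
    using h_pos L_pos by (simp add: \<sigma>_def)
  have "h * h \<le> h * (4 * L)"
    using h_pos h_le by (intro mult_left_mono) auto
  then show "\<sigma> \<le> h"
    using L_pos by (simp add: \<sigma>_def power2_eq_square field_simps)
qed

lemma norm_e: "norm e1 = 1" "norm e2 = 1"
  using unit by (simp_all add: norm_eq_sqrt_inner)

lemma v_derivative: "(v has_real_derivative \<eta> u) (at u)"
  unfolding v_def[abs_def] \<eta>_def
  using m_bounds
  by (auto intro!: derivative_eq_intros DERIV_chain2[OF posq_derivative] simp: field_simps)

lemma continuous_on_\<eta> [continuous_intros]:
  "continuous_on S f \<Longrightarrow> continuous_on S (\<lambda>x. \<eta> (f x))"
  unfolding \<eta>_def using m_bounds by (intro continuous_intros) auto

lemma continuous_on_v [continuous_intros]: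
  "continuous_on S f \<Longrightarrow> continuous_on S (\<lambda>x. v (f x))"
  unfolding v_def using m_bounds by (intro continuous_intros) auto

lemma \<eta>_nonneg: "\<eta> u \<ge> 0"
  using m_bounds by (simp add: \<eta>_def)

lemma \<eta>_le_1: "0 < u \<Longrightarrow> u < L \<Longrightarrow> \<eta> u \<le> 1"
  using m_bounds by (auto simp: \<eta>_def max_def field_simps)

lemma mono_v: "u \<le> u' \<Longrightarrow> v u \<le> v u'"
  by (rule DERIV_nonneg_imp_nondecreasing) (use v_derivative \<eta>_nonneg in blast)+

text \<open>As \<open>2 * m \<le> L\<close>, the end zones do not overlap, and on each of them the
  modulus of \<open>v\<close> is half of the right-hand side.\<close>

lemma abs_v_le: "0 < u \<Longrightarrow> u < L \<Longrightarrow> \<bar>v u\<bar> \<le> m * (\<eta> u)\<^sup>2"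
  using m_bounds by (auto simp: \<eta>_def v_def posq_def max_def power2_eq_square field_simps abs_if)

text \<open>In the left end zone the centre has abscissa (m^2 + u^2) / (2 m), a parabola that rises
  from m / 2 to m and joins the identity with slope 1. The right end is its mirror image, whence the
  substitution \<open>w = L - u\<close>.\<close>

lemma center_bounds: "0 < u \<Longrightarrow> u < L \<Longrightarrow> m / 2 \<le> u - v u \<and> u - v u \<le> L - m / 2"
proof -
  assume u: "0 < u" "u < L"
  consider "u < m" | "m \<le> u" "u \<le> L - m" | "L - m < u"
    by linarith
  then show ?thesis
  proof cases
    case 1
    then have "u - v u = (m\<^sup>2 + u\<^sup>2) / (2 * m)"
      using m_bounds u by (simp add: v_def posq_def field_simps power2_eq_square)
    moreover have "u * u \<le> m * m"
      using 1 u by (intro mult_mono) auto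
    then have "m / 2 \<le> (m\<^sup>2 + u\<^sup>2) / (2 * m)" "(m\<^sup>2 + u\<^sup>2) / (2 * m) \<le> m"
      using m_bounds by (simp_all add: field_simps power2_eq_square)
    ultimately show ?thesis
      using m_bounds by linarith
  next
    case 2
    then show ?thesis
      using m_bounds by (simp add: v_def posq_def)
  next
    case 3
    define w where "w = L - u"
    have w: "0 < w" "w < m"
      using 3 u by (auto simp: w_def)
    then have "u - v u = L - (m\<^sup>2 + w\<^sup>2) / (2 * m)"
      using m_bounds u 3 by (simp add: v_def posq_def field_simps power2_eq_square w_def)
    moreover have "w * w \<le> m * m"
      using w by (intro mult_mono) auto
    then have "m / 2 \<le> (m\<^sup>2 + w\<^sup>2) / (2 * m)" "(m\<^sup>2 + w\<^sup>2) / (2 * m) \<le> m"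
      using m_bounds by (simp_all add: field_simps power2_eq_square)
    ultimately show ?thesis
      using m_bounds by linarith
  qed
qed

text \<open>At height \<open>s = k * h\<close> the triangle has lost at most \<open>k * L\<close> at
  each end of its base. The value of \<sigma> is the height at which this loss reaches
  \<open>m / 2\<close>, the margin that \<open>center_bounds\<close> leaves.\<close>

lemma strip_in_closure:
  assumes "m / 2 \<le> c" "c \<le> L - m / 2" "0 \<le> s" "s \<le> \<sigma>"
  shows "P + c *\<^sub>R e1 + s *\<^sub>R e2 \<in> closure \<Omega>"
proof -
  obtain r where r: "0 \<le> r" "r \<le> L" "P + r *\<^sub>R e1 + h *\<^sub>R e2 \<in> closure \<Omega>"
    using R_in by blast
  have cc: "convex (closure \<Omega>)"
    by (simp add: convex_\<Omega> convex_closure)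
  define k where "k = s / h"
  have kL: "k * L \<le> m / 2"
    using assms h_pos L_pos by (simp add: k_def \<sigma>_def m_def field_simps power2_eq_square)
  have k: "0 \<le> k" "k < 1"
  proof -
    show "0 \<le> k" using assms h_pos by (simp add: k_def)
    have "k * L < L" using kL m_bounds by linarith
    then show "k < 1" using L_pos by simp
  qed
  \<comment> \<open>Abscissa of the base point whose segment to the apex passes through the given
    point, at fraction \<open>k\<close>.\<close>
  define c' where "c' = (c - k * r) / (1 - k)"
  have "k * r \<le> k * L" "k * (L - r) \<le> k * L"
    using r k by (auto intro: mult_left_mono)
  then have "0 \<le> c'" "c' \<le> L"
    using assms kL k by (auto simp: c'_def field_simps)
  have "(1 - c' / L) *\<^sub>R P + (c' / L) *\<^sub>R (P + L *\<^sub>R e1) \<in> closure \<Omega>"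
    using \<open>0 \<le> c'\<close> \<open>c' \<le> L\<close> L_pos by (intro convexD[OF cc P_in Q_in]) auto
  then have "P + c' *\<^sub>R e1 \<in> closure \<Omega>"
    using L_pos by (simp add: algebra_simps)
  then have "(1 - k) *\<^sub>R (P + c' *\<^sub>R e1) + k *\<^sub>R (P + r *\<^sub>R e1 + h *\<^sub>R e2) \<in> closure \<Omega>"
    using k r by (intro convexD[OF cc]) auto
  also have "(1 - k) *\<^sub>R (P + c' *\<^sub>R e1) + k *\<^sub>R (P + r *\<^sub>R e1 + h *\<^sub>R e2)
      = P + ((1 - k) * c' + k * r) *\<^sub>R e1 + (k * h) *\<^sub>R e2"
    by (simp add: algebra_simps)
  also have "(1 - k) * c' + k * r = c"
    using k by (simp add: c'_def)
  also have "k * h = s"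
    using h_pos by (simp add: k_def)
  finally show ?thesis .
qed

lemma g_length: "(g s t x - P) \<bullet> e1 = (x - P) \<bullet> e1 + (t - 1) * v ((x - P) \<bullet> e1)"
proof -
  have "V s x \<bullet> e1 = v ((x - P) \<bullet> e1)"
    unfolding V_def using unit by (simp add: inner_diff_left inner_add_left inner_commute[of e2 e1])
  moreover have "g s t x - P = (x - P) + (t - 1) *\<^sub>R V s x"
    by (simp add: g_def)
  ultimately show ?thesis
    by (simp only: inner_add_left inner_scaleR_left)
qed

text \<open>Beyond either end \<open>v\<close> has the outward sign, so the dilation pushes such
  points further out and they cannot land in \<Omega>.\<close>

lemma length_of_g_in:
  assumes "t \<ge> 1" "g s t x \<in> \<Omega>"
  shows "0 < (x - P) \<bullet> e1" "(x - P) \<bullet> e1 < L"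
proof -
  let ?u = "(x - P) \<bullet> e1"
  have b: "0 < ?u + (t - 1) * v ?u" "?u + (t - 1) * v ?u < L"
    using length_bound[OF assms(2)] by (auto simp: g_length)
  show "0 < ?u"
  proof (rule ccontr)
    assume "\<not> 0 < ?u"
    then have "v ?u \<le> 0"
      using m_bounds by (simp add: v_def posq_nonpos divide_nonpos_pos)
    then have "(t - 1) * v ?u \<le> 0"
      using assms(1) by (simp add: mult_nonneg_nonpos)
    with b \<open>\<not> 0 < ?u\<close> show False by simp
  qed
  show "?u < L"
  proof (rule ccontr)
    assume "\<not> ?u < L"
    then have "v ?u \<ge> 0"
      using m_bounds by (simp add: v_def posq_nonpos)
    then have "(t - 1) * v ?u \<ge> 0"
      using assms(1) by simp
    with b \<open>\<not> ?u < L\<close> show False by simp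
  qed
qed

lemma center_in_closure:
  assumes "0 < (x - P) \<bullet> e1" "(x - P) \<bullet> e1 < L" "0 \<le> s" "s \<le> \<sigma>"
  shows "x - V s x \<in> closure \<Omega>"
proof -
  have "x - V s x = P + ((x - P) \<bullet> e1 - v ((x - P) \<bullet> e1)) *\<^sub>R e1 + s *\<^sub>R e2"
    by (simp add: V_def algebra_simps)
  then show ?thesis
    using strip_in_closure center_bounds assms by metis
qed

lemma g_convex: "t \<noteq> 0 \<Longrightarrow> x = (1 / t) *\<^sub>R g s t x + (1 - 1 / t) *\<^sub>R (x - V s x)"
  unfolding g_def
  by (simp add: scaleR_add_right scaleR_diff_right scaleR_diff_left diff_divide_distrib algebra_simps)

text \<open>The part of \<open>V s x\<close> orthogonal to \<open>e1\<close> is multiplied by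
  exactly \<open>t\<close>, and the image in \<Omega> has this part bounded by \<open>h + s\<close>,
  hence by \<open>2 * h\<close>. The constant 5 is 4 for this part plus 1 for the part along
  \<open>e1\<close>. The factor \<mu> is there to match the Jacobian of
  \<open>g s t\<close>.\<close>

lemma
  assumes "t \<ge> 1" "g s t x \<in> \<Omega>" "0 \<le> s" "s \<le> \<sigma>"
  shows strip_distance: "t * \<bar>(x - P) \<bullet> e2 - s\<bar> \<le> 2 * h"
    and norm_V_bound: "t\<^sup>2 * (norm (V s x))\<^sup>2 \<le> 5 * h\<^sup>2 * \<mu> t x"
proof -
  let ?u = "(x - P) \<bullet> e1"
  define w where "w = x - P - ?u *\<^sub>R e1 - s *\<^sub>R e2"
  have u: "0 < ?u" "?u < L"
    using length_of_g_in assms by auto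
  have \<eta>: "0 \<le> \<eta> ?u" "\<eta> ?u \<le> 1"
    using \<eta>_nonneg \<eta>_le_1 u by auto
  have \<mu>1: "\<mu> t x \<ge> 1"
    using assms \<eta> by (simp add: \<mu>_def)
  have \<mu>2: "\<mu> t x \<ge> t * \<eta> ?u"
    using \<eta> by (simp add: \<mu>_def algebra_simps)
  have "t *\<^sub>R w = (g s t x - P - ((g s t x - P) \<bullet> e1) *\<^sub>R e1) - s *\<^sub>R e2"
    unfolding g_length by (simp add: w_def g_def V_def algebra_simps)
  moreover have "norm ((g s t x - P - ((g s t x - P) \<bullet> e1) *\<^sub>R e1) - s *\<^sub>R e2) \<le> h + s"
    using assms(3) norm_e
    by (intro order_trans[OF norm_triangle_ineq4 add_mono[OF width_bound[OF assms(2)]]]) simp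
  ultimately have tw: "t * norm w \<le> 2 * h"
    using assms \<sigma>_bounds by (metis abs_of_nonneg norm_scaleR add_mono order_refl order_trans mult_2 zero_le_one)
  have "w \<bullet> e2 = (x - P) \<bullet> e2 - s"
    unfolding w_def using unit by (simp add: inner_diff_left)
  then have "\<bar>(x - P) \<bullet> e2 - s\<bar> \<le> norm w"
    using Cauchy_Schwarz_ineq2[of w e2] norm_e by simp
  then show "t * \<bar>(x - P) \<bullet> e2 - s\<bar> \<le> 2 * h"
    using tw assms(1) by (intro order_trans[OF mult_left_mono tw]) auto
  have we: "w \<bullet> e1 = 0"
    unfolding w_def using unit by (simp add: inner_diff_left inner_commute[of e2 e1])
  have "V s x = w + v ?u *\<^sub>R e1"
    by (simp add: V_def w_def)
  then have "(norm (V s x))\<^sup>2 = (norm w)\<^sup>2 + (v ?u)\<^sup>2"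
    using we unit unfolding power2_norm_eq_inner
    by (simp add: inner_add_left inner_add_right inner_commute[of e1 w] power2_eq_square)
  then have eq: "t\<^sup>2 * (norm (V s x))\<^sup>2 = (t * norm w)\<^sup>2 + (t * \<bar>v ?u\<bar>)\<^sup>2"
    by (simp add: algebra_simps power2_eq_square)
  have "(t * norm w)\<^sup>2 \<le> (2 * h)\<^sup>2"
    using tw assms(1) by (intro power_mono) auto
  also have "\<dots> \<le> 4 * h\<^sup>2 * \<mu> t x"
    using mult_left_mono[OF \<mu>1, of "4 * h\<^sup>2"] by (simp add: power_mult_distrib)
  finally have 1: "(t * norm w)\<^sup>2 \<le> 4 * h\<^sup>2 * \<mu> t x" .
  \<comment> \<open>Here \<open>t * \<bar>v ?u\<bar>\<close> is the distance between the abscissas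
    of the centre and of the image of \<open>x\<close>. On an end zone the centre is within
    \<open>m\<close> of that end and the image, lying in \<Omega>, does not pass it.\<close>
  have tv: "t * \<bar>v ?u\<bar> \<le> m"
  proof (cases "v ?u = 0")
    case False
    have b: "0 < ?u + (t - 1) * v ?u" "?u + (t - 1) * v ?u < L"
      using length_bound[OF assms(2)] by (auto simp: g_length)
    consider "?u < m" | "L - m < ?u"
      using False by (force simp: v_def posq_nonpos)
    then show ?thesis
    proof cases
      case 1
      then have "?u - (L - m) \<le> 0"
        using m_bounds by linarith
      then have "v ?u = - posq (m - ?u) / (2 * m)"
        by (simp add: v_def posq_nonpos)
      then have "v ?u \<le> 0"
        using m_bounds by (simp add: divide_nonpos_pos)
      moreover have "?u - v ?u \<le> m"
      proof -
        have "?u - v ?u = (m\<^sup>2 + ?u\<^sup>2) / (2 * m)"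
          using m_bounds 1 u by (simp add: v_def posq_def field_simps power2_eq_square)
        moreover have "?u * ?u \<le> m * m"
          using 1 u by (intro mult_mono) auto
        then have "(m\<^sup>2 + ?u\<^sup>2) / (2 * m) \<le> m"
          using m_bounds by (simp add: field_simps power2_eq_square)
        ultimately show ?thesis
          by simp
      qed
      ultimately show ?thesis
        using b m_bounds by (simp add: algebra_simps abs_if)
    next
      case 2
      then have "m - ?u \<le> 0"
        using m_bounds by linarith
      then have v2: "v ?u = posq (?u - (L - m)) / (2 * m)"
        by (simp add: v_def posq_nonpos)
      then have "v ?u \<ge> 0"
        using m_bounds by simp
      moreover have "L - m \<le> ?u - v ?u"
      proof -
        define z where "z = ?u - (L - m)"
        have z: "0 < z" "z < m"
          using 2 u by (auto simp: z_def)
        then have "z * z \<le> 2 * m * z"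
          by (intro mult_right_mono) auto
        then have "posq z / (2 * m) \<le> z"
          using z m_bounds by (simp add: posq_def power2_eq_square field_simps)
        then show ?thesis
          unfolding v2 z_def by linarith
      qed
      ultimately show ?thesis
        using b by (simp add: algebra_simps)
    qed
  qed (use m_bounds in simp)
  have "(t * \<bar>v ?u\<bar>)\<^sup>2 \<le> m * (t * \<bar>v ?u\<bar>)"
    unfolding power2_eq_square using tv assms(1) by (intro mult_right_mono) auto
  also have "\<dots> \<le> m * (t * (m * (\<eta> ?u)\<^sup>2))"
    using m_bounds assms(1) abs_v_le[OF u] by (intro mult_left_mono) auto
  also have "\<dots> \<le> m * (t * (m * \<eta> ?u))"
    using m_bounds assms(1) \<eta> by (intro mult_left_mono) (auto simp: power2_eq_square mult_left_le)
  also have "\<dots> = m\<^sup>2 * (t * \<eta> ?u)"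
    by (simp add: power2_eq_square algebra_simps)
  also have "\<dots> \<le> h\<^sup>2 * \<mu> t x"
    using \<mu>2 assms(1) \<eta> h_pos by (intro mult_mono power_mono) (auto simp: m_def)
  finally show "t\<^sup>2 * (norm (V s x))\<^sup>2 \<le> 5 * h\<^sup>2 * \<mu> t x"
    using 1 by (simp add: eq)
qed

section \<open>Derivative, injectivity and determinant of the dilations\<close>

lemma V_derivative: "(V s has_derivative DV x) (at x)"
proof -
  have 1: "((\<lambda>x. (x - P) \<bullet> e1) has_derivative (\<lambda>a. a \<bullet> e1)) (at x)"
    by (auto intro!: derivative_eq_intros)
  have 2: "((\<lambda>x. v ((x - P) \<bullet> e1)) has_derivative (\<lambda>a. \<eta> ((x - P) \<bullet> e1) * (a \<bullet> e1))) (at x)"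
    using has_derivative_compose[OF 1, of v] v_derivative[of "(x - P) \<bullet> e1"]
    by (simp add: has_field_derivative_def)
  have "((\<lambda>x. x - P - ((x - P) \<bullet> e1) *\<^sub>R e1 - s *\<^sub>R e2 + v ((x - P) \<bullet> e1) *\<^sub>R e1) has_derivative
      (\<lambda>a. a - 0 - (a \<bullet> e1) *\<^sub>R e1 - 0 + (\<eta> ((x - P) \<bullet> e1) * (a \<bullet> e1)) *\<^sub>R e1)) (at x)"
    by (intro has_derivative_add has_derivative_diff has_derivative_ident has_derivative_const
        has_derivative_scaleR_left 1 2)
  then show ?thesis
    by (simp add: V_def[abs_def] DV_def[abs_def])
qed

lemma g_derivative: "(g s t has_derivative Dg t x) (at x)"
  unfolding g_def[abs_def] Dg_def[abs_def]
  by (intro has_derivative_add has_derivative_ident has_derivative_scaleR_right V_derivative)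

lemma continuous_on_V [continuous_intros]:
  "continuous_on S f \<Longrightarrow> continuous_on S (\<lambda>x. V s (f x))"
  unfolding V_def by (intro continuous_intros)

lemma continuous_on_DV [continuous_intros]:
  "continuous_on S f \<Longrightarrow> continuous_on S a \<Longrightarrow> continuous_on S (\<lambda>x. DV (f x) (a x))"
  unfolding DV_def by (intro continuous_intros)

lemma continuous_on_g [continuous_intros]:
  "continuous_on S f \<Longrightarrow> continuous_on S t \<Longrightarrow> continuous_on S (\<lambda>x. g s (t x) (f x))"
  unfolding g_def by (intro continuous_intros)

lemma continuous_on_Dg [continuous_intros]:
  "continuous_on S t \<Longrightarrow> continuous_on S f \<Longrightarrow> continuous_on S a \<Longrightarrow> continuous_on S (\<lambda>x. Dg (t x) (f x) (a x))"
  unfolding Dg_def by (intro continuous_intros)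

text \<open>Monotonicity of \<open>v\<close> makes the map of abscissas strictly increasing; between
  points of equal abscissa \<open>g s t\<close> multiplies differences by \<open>t\<close>.\<close>

lemma inj_g:
  assumes "t \<ge> 1"
  shows "inj (g s t)"
proof (rule injI)
  fix x y assume eq: "g s t x = g s t y"
  let ?u = "\<lambda>x. (x - P) \<bullet> e1"
  have "?u x + (t - 1) * v (?u x) = ?u y + (t - 1) * v (?u y)"
    using arg_cong[OF eq, of "\<lambda>z. (z - P) \<bullet> e1"] by (simp only: g_length)
  moreover have "a + (t - 1) * v a < b + (t - 1) * v b" if "a < b" for a b
    using that assms mono_v[of a b] mult_left_mono[of "v a" "v b" "t - 1"] by simp
  ultimately have "?u x = ?u y"
    by (metis linorder_neqE_linordered_idom less_irrefl)
  then have "V s x - V s y = x - y"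
    by (simp add: V_def)
  moreover have "(x - y) + (t - 1) *\<^sub>R (V s x - V s y) = 0"
    using eq by (simp add: g_def algebra_simps)
  ultimately have "(x - y) + (t - 1) *\<^sub>R (x - y) = 0"
    by simp
  then have "t *\<^sub>R (x - y) = 0"
    by (metis add.commute diff_add_cancel scaleR_add_left scaleR_one)
  then show "x = y"
    using assms by simp
qed

lemma norm_DV_le:
  assumes "0 < (x - P) \<bullet> e1" "(x - P) \<bullet> e1 < L"
  shows "norm (DV x a) \<le> norm a"
proof -
  let ?k = "\<eta> ((x - P) \<bullet> e1)"
  have k: "0 \<le> ?k" "?k \<le> 1"
    using \<eta>_nonneg \<eta>_le_1 assms by auto
  have "(norm (DV x a))\<^sup>2 = (norm a)\<^sup>2 - (1 - ?k\<^sup>2) * (a \<bullet> e1)\<^sup>2"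
    unfolding power2_norm_eq_inner DV_def using unit
    by (simp add: inner_add_left inner_add_right inner_diff_left inner_diff_right inner_commute
        power2_eq_square algebra_simps)
  also have "\<dots> \<le> (norm a)\<^sup>2"
    using k by (simp add: power_le_one)
  finally show ?thesis
    by (rule power2_le_imp_le) simp
qed

lemma norm_Dg_le:
  assumes "0 < (x - P) \<bullet> e1" "(x - P) \<bullet> e1 < L" "t \<ge> 1"
  shows "norm (Dg t x a) \<le> t * norm a"
proof -
  have "norm (Dg t x a) \<le> norm a + (t - 1) * norm (DV x a)"
    unfolding Dg_def using assms(3) by (intro order_trans[OF norm_triangle_ineq]) simp
  also have "\<dots> \<le> norm a + (t - 1) * norm a"
    using norm_DV_le[OF assms(1,2)] assms(3) by (intro add_left_mono mult_left_mono) auto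
  finally show ?thesis
    by (simp add: algebra_simps)
qed

lemma Dg_symmetric: "Dg t x a \<bullet> b = a \<bullet> Dg t x b"
  by (simp add: Dg_def DV_def inner_add_left inner_add_right inner_diff_left inner_diff_right
      inner_commute algebra_simps)

lemma det_Dg: "det (matrix (Dg t x)) = t\<^sup>2 * \<mu> t x"
proof -
  let ?k = "(t - 1) * (1 - \<eta> ((x - P) \<bullet> e1))"
  have e: "e1 $ 1 * e1 $ 1 + e1 $ 2 * e1 $ 2 + e1 $ 3 * e1 $ 3 = 1"
    using unit(1) by (simp add: inner_vec_def sum_3)
  have ax: "axis j 1 \<bullet> e1 = e1 $ j" for j
    by (simp add: inner_axis')
  have M: "matrix (Dg t x) $ i $ j = (if i = j then t else 0) - ?k * e1 $ i * e1 $ j" for i j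
    unfolding matrix_def Dg_def DV_def ax by (simp add: axis_def algebra_simps)
  have "det (matrix (Dg t x)) = t ^ 3 - t\<^sup>2 * ?k * (e1 $ 1 * e1 $ 1 + e1 $ 2 * e1 $ 2 + e1 $ 3 * e1 $ 3)"
    unfolding det_3 M by (simp add: power3_eq_cube power2_eq_square) algebra
  then show ?thesis
    unfolding e by (simp add: \<mu>_def power3_eq_cube power2_eq_square algebra_simps)
qed

end

section \<open>The homotopy formula\<close>

definition directional :: "(real^3 \<Rightarrow> real^3) \<Rightarrow> real^3 \<Rightarrow> real^3 \<Rightarrow> real^3" where
  "directional F z a = (\<Sum>i\<in>UNIV. a $ i *\<^sub>R partial i F z)"

text \<open>The exterior derivative of the 1-form \<open>F\<close> in vector notation.\<close>

lemma directional_antisymmetric: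
  "directional F z a \<bullet> b - directional F z b \<bullet> a = cross3 (curl F z) a \<bullet> b"
  by (simp add: directional_def curl_def cross3_simps)

lemma norm_cross3_le: "norm (cross3 a b) \<le> norm a * norm b"
proof (rule power2_le_imp_le)
  show "(norm (cross3 a b))\<^sup>2 \<le> (norm a * norm b)\<^sup>2"
    using norm_cross[of a b] by (simp add: power_mult_distrib)
qed simp

lemma C1_directional: "C1 F \<Longrightarrow> (F has_derivative directional F x) (at x)"
  unfolding directional_def[abs_def] by (rule C1_has_derivative)

lemma continuous_on_directional:
  assumes "C1 F" "continuous_on S f" "continuous_on S a"
  shows "continuous_on S (\<lambda>x. directional F (f x) (a x))"
proof -
  have "continuous_on S (\<lambda>x. partial i F (f x))" for i
    using continuous_on_compose2[OF C1_continuous_on_partial[OF assms(1), of UNIV] assms(2)] by simp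
  then show ?thesis
    unfolding directional_def by (intro continuous_intros assms)
qed

lemma continuous_on_vector_3:
  fixes a b c :: "'a::topological_space \<Rightarrow> real"
  assumes "continuous_on S a" "continuous_on S b" "continuous_on S c"
  shows "continuous_on S (\<lambda>x. vector [a x, b x, c x] :: real^3)"
proof -
  have eq: "(\<lambda>x. vector [a x, b x, c x] :: real^3)
      = (\<lambda>x. a x *\<^sub>R axis 1 1 + b x *\<^sub>R axis 2 1 + c x *\<^sub>R axis 3 1)"
    by (auto simp: fun_eq_iff vec_eq_iff forall_3 axis_def)
  show ?thesis
    unfolding eq by (intro continuous_intros assms)
qed

lemma continuous_on_curl:
  assumes "C1 F"
  shows "continuous_on S (curl F)"
  unfolding curl_def[abs_def]
  by (intro continuous_on_vector_3 continuous_intros C1_continuous_on_partial assms)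

lemma curl_outside_supp: "x \<notin> supp F \<Longrightarrow> curl F x = 0"
  by (simp add: curl_def partial_outside_supp vec_eq_iff forall_3)

lemma continuous_on_cross3 [continuous_intros]:
  assumes "continuous_on S f" "continuous_on S g"
  shows "continuous_on S (\<lambda>x. cross3 (f x) (g x))"
  unfolding cross3_def by (intro continuous_on_vector_3 continuous_intros assms)

context thin_frame
begin

text \<open>Cartan's homotopy operator: \<open>V s x\<close> is the velocity of
  \<open>g s t x\<close> in \<open>t\<close>, and the 1-form \<open>F\<close> is contracted with it.
  Likewise \<open>K\<close> is the pullback of the contracted exterior derivative; \<open>Dg\<close>
  stands where its transpose is due, by \<open>Dg_symmetric\<close>.\<close>

definition "\<Psi> F s T x = integral {1..T} (\<lambda>t. F (g s t x) \<bullet> V s x)"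
definition "K F s t x = Dg t x (cross3 (curl F (g s t x)) (V s x))"

lemma \<Psi>_C1:
  assumes F: "C1 F"
  shows "C1 (\<Psi> F s T)"
    and "partial i (\<Psi> F s T) x = integral {1..T} (\<lambda>t. F (g s t x) \<bullet> DV x (axis i 1)
           + directional F (g s t x) (Dg t x (axis i 1)) \<bullet> V s x)"
proof -
  let ?D = "\<lambda>x t a. F (g s t x) \<bullet> DV x a + directional F (g s t x) (Dg t x a) \<bullet> V s x"
  have d: "((\<lambda>x. F (g s t x) \<bullet> V s x) has_derivative ?D x t) (at x)" for t x
    by (intro has_derivative_inner has_derivative_compose[of "g s t" _ _ _ F] g_derivative V_derivative C1_directional F)
  have cF: "continuous_on S F" for S
    by (rule C1_continuous_on[OF F])
  have c: "continuous_on (cbox 1 T) (\<lambda>t. F (g s t x) \<bullet> V s x)" for x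
    by (intro continuous_intros continuous_on_compose2[OF cF[of UNIV]]) auto
  have cD: "continuous_on (UNIV \<times> cbox 1 T) (\<lambda>(x, t). ?D x t (axis i 1))" for i
    unfolding case_prod_unfold
    by (intro continuous_intros continuous_on_compose2[OF cF[of UNIV]] continuous_on_directional F) auto
  show "C1 (\<Psi> F s T)"
    using leibniz_C1(1)[OF d c cD] by (simp add: \<Psi>_def[abs_def])
  show "partial i (\<Psi> F s T) x = integral {1..T} (\<lambda>t. ?D x t (axis i 1))"
    using leibniz_C1(2)[OF d c cD] by (simp add: \<Psi>_def[abs_def])
qed

lemma continuous_on_K:
  assumes "C1 F" "continuous_on S t" "continuous_on S f"
  shows "continuous_on S (\<lambda>x. K F s (t x) (f x))"
  unfolding K_def
  by (intro continuous_intros assms continuous_on_compose2[OF continuous_on_curl[OF assms(1), of UNIV]]) auto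

text \<open>Cartan's formula for the pullbacks of the 1-form \<open>F\<close> under \<open>g s t\<close>, integrated over \<open>t\<close>.\<close>

lemma homotopy_formula:
  assumes F: "C1 F" and T: "1 \<le> T"
  shows "F x = Dg T x (F (g s T x)) - grad (\<Psi> F s T) x - integral {1..T} (\<lambda>t. K F s t x)"
proof -
  have "F x $ i = (Dg T x (F (g s T x)) - grad (\<Psi> F s T) x - integral {1..T} (\<lambda>t. K F s t x)) $ i" for i
  proof -
    let ?a = "axis i 1 :: real^3"
    \<comment> \<open>\<open>?p\<close> is the derivative in \<open>t\<close> of a component of the
      pulled back field and \<open>?q\<close> the integrand of the partial derivative of \<Psi>.
      Their difference is the antisymmetric part of the derivative of \<open>F\<close>, which is the
      curl term.\<close>
    let ?p = "\<lambda>t. directional F (g s t x) (V s x) \<bullet> Dg t x ?a + F (g s t x) \<bullet> DV x ?a"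
    let ?q = "\<lambda>t. F (g s t x) \<bullet> DV x ?a + directional F (g s t x) (Dg t x ?a) \<bullet> V s x"
    have cF: "continuous_on S F" for S
      by (rule C1_continuous_on[OF F])
    have "(?p has_integral (F (g s T x) \<bullet> Dg T x ?a - F (g s 1 x) \<bullet> Dg 1 x ?a)) {1..T}"
    proof (rule fundamental_theorem_of_calculus[OF T])
      fix t assume "t \<in> {1..T}"
      have 1: "((\<lambda>t. g s t x) has_derivative (\<lambda>k. k *\<^sub>R V s x)) (at t within {1..T})"
        unfolding g_def by (auto intro!: derivative_eq_intros)
      have 2: "((\<lambda>t. Dg t x ?a) has_derivative (\<lambda>k. k *\<^sub>R DV x ?a)) (at t within {1..T})"
        unfolding Dg_def by (auto intro!: derivative_eq_intros)
      have "((\<lambda>t. F (g s t x) \<bullet> Dg t x ?a) has_derivative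
          (\<lambda>k. F (g s t x) \<bullet> (k *\<^sub>R DV x ?a) + directional F (g s t x) (k *\<^sub>R V s x) \<bullet> Dg t x ?a)) (at t within {1..T})"
        by (intro has_derivative_inner 2 has_derivative_compose[OF 1] C1_directional F)
      moreover have "directional F (g s t x) (k *\<^sub>R V s x) = k *\<^sub>R directional F (g s t x) (V s x)" for k
        by (simp add: directional_def scaleR_sum_right)
      ultimately show "((\<lambda>t. F (g s t x) \<bullet> Dg t x ?a) has_vector_derivative ?p t) (at t within {1..T})"
        by (simp add: has_vector_derivative_def algebra_simps)
    qed
    then have P: "integral {1..T} ?p = F (g s T x) \<bullet> Dg T x ?a - F x \<bullet> ?a" "?p integrable_on {1..T}"
      by (auto simp: has_integral_iff g_def Dg_def)
    have "continuous_on {1..T} ?q"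
      by (intro continuous_intros continuous_on_compose2[OF cF[of UNIV]] continuous_on_directional F) auto
    then have q: "?q integrable_on {1..T}"
      by (rule integrable_continuous_real)
    have Kc: "(\<lambda>t. K F s t x) integrable_on {1..T}"
      by (intro integrable_continuous_real continuous_on_K F continuous_intros)
    have "?p t - ?q t = K F s t x $ i" for t
    proof -
      have "?p t - ?q t = cross3 (curl F (g s t x)) (V s x) \<bullet> Dg t x ?a"
        using directional_antisymmetric[of F "g s t x" "V s x" "Dg t x ?a"] by simp
      also have "\<dots> = K F s t x \<bullet> ?a"
        by (simp add: K_def Dg_symmetric)
      finally show ?thesis
        by (simp add: inner_axis)
    qed
    then have "integral {1..T} ?p - integral {1..T} ?q = integral {1..T} (\<lambda>t. K F s t x $ i)"
      using integral_diff[OF P(2) q] by simp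
    then have "F x \<bullet> ?a = F (g s T x) \<bullet> Dg T x ?a - partial i (\<Psi> F s T) x - integral {1..T} (\<lambda>t. K F s t x) $ i"
      using P(1) \<Psi>_C1(2)[OF F, of i s T x] Kc by simp
    moreover have "F (g s T x) \<bullet> Dg T x ?a = Dg T x (F (g s T x)) \<bullet> ?a"
      by (simp add: Dg_symmetric)
    ultimately show ?thesis
      by (simp add: inner_axis grad_def)
  qed
  then show ?thesis
    by (simp add: vec_eq_iff)
qed

text \<open>Where the integrand is nonzero, the point lies on a segment from a centre in the closure
  of \<Omega> to a point of \<open>supp F\<close>, at fraction at least 1 / T from the centre.
  Finiteness of \<open>T\<close> keeps such points away from the centres, which may lie on the
  boundary.\<close>

lemma \<Psi>_support:
  assumes F: "compact (supp F)" "supp F \<subseteq> \<Omega>" and s: "0 \<le> s" "s \<le> \<sigma>" and T: "1 \<le> T"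
  shows "compact (supp (\<Psi> F s T))" "supp (\<Psi> F s T) \<subseteq> \<Omega>"
proof -
  define f where "f = (\<lambda>(t, z, c). (1 / t) *\<^sub>R z + (1 - 1 / t) *\<^sub>R (c :: real^3) :: real^3)"
  define A where "A = f ` ({1..T} \<times> supp F \<times> closure \<Omega>)"
  have "compact (closure \<Omega>)"
    using bounded_\<Omega> by simp
  moreover have "continuous_on ({1..T} \<times> supp F \<times> closure \<Omega>) f"
    unfolding f_def case_prod_unfold by (intro continuous_intros) auto
  ultimately have A: "compact A"
    unfolding A_def by (intro compact_continuous_image compact_Times F) auto
  have A_sub: "A \<subseteq> \<Omega>"
  proof
    fix x assume "x \<in> A"
    then obtain p where p: "p \<in> {1..T} \<times> supp F \<times> closure \<Omega>" "x = f p"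
      unfolding A_def by blast
    obtain t z c where "p = (t, z, c)"
      by (cases p)
    with p F(2) have t: "1 \<le> t" and z: "z \<in> \<Omega>" and c: "c \<in> closure \<Omega>"
      and x: "x = (1 / t) *\<^sub>R z + (1 - 1 / t) *\<^sub>R c"
      by (auto simp: f_def)
    have "c - (1 / t) *\<^sub>R (c - z) \<in> interior \<Omega>"
      using t z c by (intro mem_interior_closure_convex_shrink convex_\<Omega>) (auto simp: open_\<Omega> interior_open)
    also have "c - (1 / t) *\<^sub>R (c - z) = x"
      by (simp add: x algebra_simps)
    finally show "x \<in> \<Omega>"
      using interior_subset by blast
  qed
  have zero: "\<Psi> F s T x = 0" if "x \<notin> A" for x
  proof -
    have "F (g s t x) = 0" if t: "t \<in> {1..T}" for t
    proof (rule ccontr)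
      assume "F (g s t x) \<noteq> 0"
      then have z: "g s t x \<in> supp F"
        using notin_supp by blast
      then have "x - V s x \<in> closure \<Omega>"
        using F(2) t s by (intro center_in_closure length_of_g_in[of t s]) auto
      then have "f (t, g s t x, x - V s x) \<in> A"
        unfolding A_def using t z by auto
      also have "f (t, g s t x, x - V s x) = x"
        using g_convex[of t x s] t by (simp add: f_def)
      finally show False
        using \<open>x \<notin> A\<close> by simp
    qed
    then have "\<Psi> F s T x = integral {1..T} (\<lambda>t. 0)"
      unfolding \<Psi>_def by (intro integral_cong) simp
    then show ?thesis by simp
  qed
  show "compact (supp (\<Psi> F s T))"
    by (rule compact_supp[OF A zero])
  show "supp (\<Psi> F s T) \<subseteq> \<Omega>"
    by (rule order_trans[OF supp_subset[OF compact_imp_closed[OF A] zero] A_sub])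
qed

text \<open>Change of variables with the determinant from \<open>det_Dg\<close>. It is an inequality
  because the image of \<Omega> is only compared with the whole space, outside \<Omega> of which
  \<rho> vanishes.\<close>

lemma nn_integral_g_le:
  fixes \<rho> :: "real^3 \<Rightarrow> real"
  assumes \<rho>: "continuous_on UNIV \<rho>" "\<And>x. \<rho> x \<ge> 0" and C: "compact C" "C \<subseteq> \<Omega>" "\<And>x. x \<notin> C \<Longrightarrow> \<rho> x = 0"
    and t: "1 \<le> t"
  shows "(\<integral>\<^sup>+ x. ennreal (t\<^sup>2 * \<mu> t x * \<rho> (g s t x)) \<partial>lebesgue_on \<Omega>) \<le> ennreal (\<integral>x. \<rho> x \<partial>lebesgue_on \<Omega>)"
proof -
  have \<Omega>s: "\<Omega> \<in> sets lebesgue"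
    using open_\<Omega> by auto
  have inj: "inj_on (g s t) \<Omega>"
    using inj_g[OF t] by (rule inj_on_subset) auto
  have "open (g s t ` \<Omega>)"
    by (intro invariance_of_domain open_\<Omega> inj continuous_intros)
  then have gs: "g s t ` \<Omega> \<in> sets lebesgue"
    by auto
  have "integrable lborel (\<lambda>x. indicator C x *\<^sub>R \<rho> x)"
    by (intro borel_integrable_compact C continuous_on_subset[OF \<rho>(1)]) auto
  also have "(\<lambda>x. indicator C x *\<^sub>R \<rho> x) = \<rho>"
    using C(3) by (auto simp: fun_eq_iff indicator_def)
  finally have "integrable lebesgue \<rho>"
    using \<rho>(1) by (simp add: integrable_completion borel_measurable_continuous_onI)
  then have U: "\<rho> absolutely_integrable_on UNIV"
    by (simp add: set_integrable_def)
  then have a: "\<rho> absolutely_integrable_on S" if "S \<in> sets lebesgue" for S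
    using that by (rule set_integrable_subset) auto
  \<comment> \<open>The change-of-variables theorem takes values in \<open>real^'n\<close>, so
    \<rho> is carried by the single coordinate of \<open>real^1\<close>.\<close>
  define F where "F = (\<lambda>x. \<rho> x *\<^sub>R (axis 1 1 :: real^1))"
  have "((\<lambda>r. r *\<^sub>R (axis 1 1 :: real^1)) \<circ> \<rho>) absolutely_integrable_on g s t ` \<Omega>"
    by (intro absolutely_integrable_linear a gs bounded_linear_scaleR_left)
  then have Fa: "F absolutely_integrable_on g s t ` \<Omega>"
    by (simp add: F_def o_def)
  let ?G = "\<lambda>x. \<bar>det (matrix (Dg t x))\<bar> *\<^sub>R F (g s t x)"
  have G: "?G absolutely_integrable_on \<Omega>" "integral \<Omega> ?G = integral (g s t ` \<Omega>) F"
    using has_absolute_integral_change_of_variables[OF \<Omega>s has_derivative_at_withinI[OF g_derivative] inj, of F "integral (g s t ` \<Omega>) F"] Fa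
    by auto
  have F1: "F x $ 1 = \<rho> x" for x
    by (simp add: F_def axis_def)
  let ?r = "\<lambda>x. t\<^sup>2 * \<mu> t x * \<rho> (g s t x)"
  have \<mu>: "\<mu> t x \<ge> 0" for x
    using \<eta>_nonneg t by (simp add: \<mu>_def)
  have Gr: "?G x $ 1 = ?r x" for x
    using \<mu>[of x] by (simp add: det_Dg F1)
  have "((\<lambda>v. v $ 1) \<circ> ?G) absolutely_integrable_on \<Omega>"
    by (intro absolutely_integrable_linear G bounded_linear_vec_nth)
  then have r: "?r absolutely_integrable_on \<Omega>"
    unfolding o_def Gr .
  have r_int: "integrable (lebesgue_on \<Omega>) ?r"
    using absolutely_integrable_imp_integrable[OF r \<Omega>s] .
  have "(\<integral>\<^sup>+ x. ennreal (?r x) \<partial>lebesgue_on \<Omega>) = ennreal (\<integral>x. ?r x \<partial>lebesgue_on \<Omega>)"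
    using \<mu> \<rho>(2) by (intro nn_integral_eq_integral r_int) auto
  also have "(\<integral>x. ?r x \<partial>lebesgue_on \<Omega>) = integral \<Omega> ?r"
    by (rule lebesgue_integral_eq_integral[OF r_int \<Omega>s])
  also have "\<dots> = integral \<Omega> ?G $ 1"
    using integral_component_eq_cart[OF set_lebesgue_integral_eq_integral(1)[OF G(1)], of 1] unfolding Gr by simp
  also have "\<dots> = integral (g s t ` \<Omega>) \<rho>"
    using integral_component_eq_cart[OF set_lebesgue_integral_eq_integral(1)[OF Fa], of 1] unfolding G(2) F1 by simp
  also have "\<dots> \<le> integral UNIV \<rho>"
    using \<rho>(2) a[OF gs] U by (intro integral_subset_le) (auto simp: set_lebesgue_integral_eq_integral)
  also have "\<dots> = integral \<Omega> \<rho>"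
    using C by (intro integral_eq_integral_UNIV[symmetric]) auto
  also have "\<dots> = (\<integral>x. \<rho> x \<partial>lebesgue_on \<Omega>)"
    by (rule lebesgue_integral_eq_integral[symmetric, OF absolutely_integrable_imp_integrable[OF a[OF \<Omega>s] \<Omega>s] \<Omega>s])
  finally show ?thesis
    by (simp add: ennreal_leI)
qed

end

section \<open>Choosing the centre line\<close>

lemma nn_integral_three_halves_le:
  assumes "1 \<le> T"
  shows "(\<integral>\<^sup>+ t. ennreal (1 / (t * sqrt t)) * indicator {1..T} t \<partial>lborel) \<le> 2"
proof -
  have "(\<integral>\<^sup>+ t. ennreal (1 / (t * sqrt t)) * indicator {1..T} t \<partial>lborel) = ennreal (- 2 / sqrt T - (- 2 / sqrt 1))"
  proof (rule nn_integral_FTC_Icc)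
    fix t assume "t \<in> {1..T}"
    then have t: "1 \<le> t" by simp
    show "((\<lambda>t. - 2 / sqrt t) has_real_derivative 1 / (t * sqrt t)) (at t)"
      using t by (auto intro!: derivative_eq_intros simp: field_simps)
    show "0 \<le> 1 / (t * sqrt t)"
      using t by simp
  qed (use assms in auto)
  also have "\<dots> \<le> ennreal 2"
    using assms by (intro ennreal_leI) simp
  finally show ?thesis by simp
qed

text \<open>Nonnegative integrals allow its use before integrability of the product has been
  established.\<close>

lemma Cauchy_Schwarz_bound:
  assumes [measurable]: "f \<in> borel_measurable M" "g \<in> borel_measurable M"
    and u: "ennreal \<bar>u\<bar> \<le> (\<integral>\<^sup>+ x. f x * g x \<partial>M)"
    and f: "(\<integral>\<^sup>+ x. (f x)\<^sup>2 \<partial>M) \<le> ennreal A" and g: "(\<integral>\<^sup>+ x. (g x)\<^sup>2 \<partial>M) \<le> ennreal B"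
    and "0 \<le> A" "0 \<le> B"
  shows "\<bar>u\<bar> \<le> sqrt (A * B)"
proof -
  have "ennreal (\<bar>u\<bar>\<^sup>2) = (ennreal \<bar>u\<bar>)\<^sup>2"
    by (simp add: ennreal_power)
  also have "\<dots> \<le> (\<integral>\<^sup>+ x. f x * g x \<partial>M)\<^sup>2"
    by (intro power_mono u) simp
  also have "\<dots> \<le> (\<integral>\<^sup>+ x. (f x)\<^sup>2 \<partial>M) * (\<integral>\<^sup>+ x. (g x)\<^sup>2 \<partial>M)"
    by (rule Cauchy_Schwarz_nn_integral) measurable
  also have "\<dots> \<le> ennreal A * ennreal B"
    by (intro mult_mono f g) auto
  also have "\<dots> = ennreal (A * B)"
    using assms by (simp add: ennreal_mult)
  finally have "\<bar>u\<bar>\<^sup>2 \<le> A * B"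
    using assms by (simp add: ennreal_le_iff)
  then show ?thesis
    by (simp add: real_le_rsqrt)
qed

lemma continuous_pair_measurable:
  fixes f :: "real \<times> (real^3) \<Rightarrow> 'b::{second_countable_topology, real_normed_vector}"
  assumes "continuous_on UNIV f"
  shows "f \<in> borel_measurable (lborel \<Otimes>\<^sub>M lebesgue_on \<Omega>)"
proof -
  have f: "f \<in> borel_measurable (borel \<Otimes>\<^sub>M borel)"
    unfolding borel_prod by (rule borel_measurable_continuous_onI[OF assms])
  have [measurable]: "(\<lambda>x. x) \<in> borel_measurable (lebesgue_on \<Omega>)"
    by (rule continuous_lebesgue_on_measurable) simp
  have "(\<lambda>p. (fst p, snd p)) \<in> (lborel \<Otimes>\<^sub>M lebesgue_on \<Omega>) \<rightarrow>\<^sub>M (borel \<Otimes>\<^sub>M borel)"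
    by measurable
  from measurable_compose[OF this f] show ?thesis
    by simp
qed

context thin_frame
begin

text \<open>The exponent comes from splitting the product of \<open>E\<close> and \<open>K\<close>
  into \<open>E\<close> over t^(1/4) and \<open>K\<close> times t^(1/4). The square of the second
  integrates in y to order t^(1/2) t^(-2), that of the first, averaged over \<open>s\<close>, to
  order t^(-1/2) t^(-1). Any power of t strictly between 0 and 1 in place of 1/2 would make both
  integrable.\<close>

definition weight :: "(real^3 \<Rightarrow> real^3) \<Rightarrow> real \<Rightarrow> real \<Rightarrow> real \<Rightarrow> real^3 \<Rightarrow> real" where
  "weight E T s t y = (if 1 \<le> t \<and> t \<le> T \<and> t * \<bar>(y - P) \<bullet> e2 - s\<bar> \<le> 2 * h
     then (norm (E y))\<^sup>2 / sqrt t else 0)"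

abbreviation "M \<equiv> lebesgue_on \<Omega>"

lemma finite_M: "finite_measure M"
  by (intro finite_measure_lebesgue_on bounded_open_lmeasurable bounded_\<Omega> open_\<Omega>)

lemma sigma_finite_M: "sigma_finite_measure M"
  using finite_M by (simp add: finite_measure_def)

lemma sigma_finite_pair: "sigma_finite_measure (lborel \<Otimes>\<^sub>M M)"
  by (intro sigma_finite_pair_measure sigma_finite_M lborel.sigma_finite_measure_axioms)

lemma e2_coordinate_measurable [measurable]: "(\<lambda>y. (y - P) \<bullet> e2) \<in> borel_measurable M"
  by (intro continuous_lebesgue_on_measurable continuous_intros)

lemma weight_measurable [measurable]:
  assumes E: "E \<in> borel_measurable M"
    and [measurable]: "a \<in> borel_measurable N" "b \<in> borel_measurable N" and k: "k \<in> N \<rightarrow>\<^sub>M M"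
  shows "(\<lambda>x. weight E T (a x) (b x) (k x)) \<in> borel_measurable N"
proof -
  have [measurable]: "(\<lambda>x. E (k x)) \<in> borel_measurable N" "(\<lambda>x. (k x - P) \<bullet> e2) \<in> borel_measurable N"
    using measurable_compose[OF k E] measurable_compose[OF k e2_coordinate_measurable] by auto
  show ?thesis
    unfolding weight_def by measurable
qed

lemma weight_nonneg: "0 \<le> weight E T s t y"
  by (auto simp: weight_def)

text \<open>
  For a fixed centre line the weighted integral may diverge, when \<open>E\<close> concentrates on the line.
  Its average over \<open>s\<close> does not, because \<open>t * \<bar>(y - P) \<bullet> e2 - s\<bar> \<le> 2 * h\<close> confines \<open>s\<close> to an interval of
  length \<open>4 * h / t\<close>.
\<close>

lemma exists_good_line:
  assumes E: "E \<in> L2 \<Omega>" and T: "1 \<le> T" and pos: "0 < (\<integral>y. (norm (E y))\<^sup>2 \<partial>M)"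
  obtains s where "0 \<le> s" "s \<le> \<sigma>"
    "(\<integral>\<^sup>+ (t, y). ennreal (weight E T s t y) \<partial>(lborel \<Otimes>\<^sub>M M))
       \<le> ennreal (9 * h / \<sigma> * (\<integral>y. (norm (E y))\<^sup>2 \<partial>M))"
proof (rule ccontr)
  define e where "e = (\<integral>y. (norm (E y))\<^sup>2 \<partial>M)"
  define \<Theta> where "\<Theta> s = (\<integral>\<^sup>+ (t, y). ennreal (weight E T s t y) \<partial>(lborel \<Otimes>\<^sub>M M))" for s
  assume no: "\<not> thesis"
  note good = that
  have less: "ennreal (9 * h / \<sigma> * e) \<le> \<Theta> s" if s: "0 \<le> s" "s \<le> \<sigma>" for s
  proof (rule ccontr)
    assume "\<not> ennreal (9 * h / \<sigma> * e) \<le> \<Theta> s"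
    then have thesis
      using good[OF s] by (simp add: \<Theta>_def e_def)
    with no show False ..
  qed
  have E1[measurable]: "E \<in> borel_measurable M" and E2: "integrable M (\<lambda>y. (norm (E y))\<^sup>2)"
    using E by (auto simp: L2_def)
  have e: "(\<integral>\<^sup>+ y. ennreal ((norm (E y))\<^sup>2) \<partial>M) = ennreal e"
    unfolding e_def by (intro nn_integral_eq_integral E2) simp
  interpret M: sigma_finite_measure M by (rule sigma_finite_M)
  interpret N: sigma_finite_measure "lborel \<Otimes>\<^sub>M M" by (rule sigma_finite_pair)
  interpret pair_sigma_finite lborel "lborel \<Otimes>\<^sub>M M" ..
  have [measurable]: "(\<lambda>x. indicator {0..\<sigma>} (fst x) :: ennreal) \<in> borel_measurable (lborel \<Otimes>\<^sub>M lborel \<Otimes>\<^sub>M M)"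
    by (intro measurable_compose[OF measurable_fst]) simp
  have [measurable]: "(\<lambda>x. ennreal (weight E T (fst x) (fst (snd x)) (snd (snd x))))
      \<in> borel_measurable (lborel \<Otimes>\<^sub>M lborel \<Otimes>\<^sub>M M)"
    by measurable
  \<comment> \<open>If every line were bad, integrating over \<open>s\<close> would give at least
    \<open>9 * h * e\<close>. Fubini gives at most \<open>4 * h * 2 * e\<close>; since
    \<open>e\<close> is positive, the slack between 8 and 9 yields the contradiction.\<close>
  have "ennreal (9 * h * e) = ennreal (9 * h / \<sigma> * e) * emeasure lborel {0..\<sigma>}"
    using \<sigma>_bounds h_pos pos by (simp add: e_def ennreal_mult[symmetric] mult.commute)
  also have "\<dots> = (\<integral>\<^sup>+ s. ennreal (9 * h / \<sigma> * e) * indicator {0..\<sigma>} s \<partial>lborel)"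
    by (simp add: nn_integral_cmult_indicator)
  also have "\<dots> \<le> (\<integral>\<^sup>+ s. \<Theta> s * indicator {0..\<sigma>} s \<partial>lborel)"
    using less by (intro nn_integral_mono) (auto simp: indicator_def)
  also have "\<dots> = (\<integral>\<^sup>+ s. (\<integral>\<^sup>+ p. (case p of (t, y) \<Rightarrow> ennreal (weight E T s t y)) * indicator {0..\<sigma>} s \<partial>(lborel \<Otimes>\<^sub>M M)) \<partial>lborel)"
    unfolding \<Theta>_def by (intro nn_integral_cong nn_integral_multc[symmetric]) measurable
  also have "\<dots> = (\<integral>\<^sup>+ p. (\<integral>\<^sup>+ s. (case p of (t, y) \<Rightarrow> ennreal (weight E T s t y)) * indicator {0..\<sigma>} s \<partial>lborel) \<partial>(lborel \<Otimes>\<^sub>M M))"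
    by (rule Fubini'[symmetric]) (simp add: case_prod_unfold)
  also have "\<dots> \<le> (\<integral>\<^sup>+ p. (case p of (t, y) \<Rightarrow> ennreal ((norm (E y))\<^sup>2) *
      (ennreal (4 * h) * (ennreal (1 / (t * sqrt t)) * indicator {1..T} t))) \<partial>(lborel \<Otimes>\<^sub>M M))"
  proof (intro nn_integral_mono, clarify)
    fix t y
    let ?y = "(y - P) \<bullet> e2"
    show "(\<integral>\<^sup>+ s. ennreal (weight E T s t y) * indicator {0..\<sigma>} s \<partial>lborel)
        \<le> ennreal ((norm (E y))\<^sup>2) * (ennreal (4 * h) * (ennreal (1 / (t * sqrt t)) * indicator {1..T} t))"
    proof (cases "1 \<le> t \<and> t \<le> T")
      case True
      then have t: "0 < t" by simp
      let ?I = "{?y - 2 * h / t..?y + 2 * h / t}"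
      have "(\<integral>\<^sup>+ s. ennreal (weight E T s t y) * indicator {0..\<sigma>} s \<partial>lborel)
          \<le> (\<integral>\<^sup>+ s. ennreal ((norm (E y))\<^sup>2 / sqrt t) * indicator ?I s \<partial>lborel)"
      proof (rule nn_integral_mono)
        fix s
        show "ennreal (weight E T s t y) * indicator {0..\<sigma>} s \<le> ennreal ((norm (E y))\<^sup>2 / sqrt t) * indicator ?I s"
        proof (cases "t * \<bar>?y - s\<bar> \<le> 2 * h")
          case True
          then have "\<bar>?y - s\<bar> \<le> 2 * h / t"
            using t by (simp add: field_simps)
          then have "s \<in> ?I"
            by (auto simp: abs_le_iff)
          then show ?thesis
            by (auto simp: weight_def indicator_def)
        qed (simp add: weight_def)
      qed
      also have "\<dots> = ennreal ((norm (E y))\<^sup>2 / sqrt t) * ennreal (4 * h / t)"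
        using t h_pos by (subst nn_integral_cmult_indicator) auto
      also have "\<dots> = ennreal ((norm (E y))\<^sup>2) * (ennreal (4 * h) * (ennreal (1 / (t * sqrt t)) * indicator {1..T} t))"
        using True t h_pos by (simp add: ennreal_mult[symmetric] field_simps)
      finally show ?thesis .
    qed (auto simp: weight_def)
  qed
  also have "\<dots> = (\<integral>\<^sup>+ t. (\<integral>\<^sup>+ y. ennreal ((norm (E y))\<^sup>2) *
      (ennreal (4 * h) * (ennreal (1 / (t * sqrt t)) * indicator {1..T} t)) \<partial>M) \<partial>lborel)"
    by (subst M.nn_integral_fst[symmetric]) (auto simp: case_prod_unfold)
  also have "\<dots> = (\<integral>\<^sup>+ t. ennreal e * ennreal (4 * h) * (ennreal (1 / (t * sqrt t)) * indicator {1..T} t) \<partial>lborel)"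
    by (intro nn_integral_cong, subst nn_integral_multc) (auto simp: e mult.assoc)
  also have "\<dots> = ennreal e * ennreal (4 * h) * (\<integral>\<^sup>+ t. (ennreal (1 / (t * sqrt t)) * indicator {1..T} t) \<partial>lborel)"
    by (rule nn_integral_cmult) measurable
  also have "\<dots> \<le> ennreal e * ennreal (4 * h) * 2"
    by (intro mult_left_mono nn_integral_three_halves_le T) simp
  also have "\<dots> = ennreal (8 * h * e)"
    using h_pos pos by (simp add: e_def ennreal_mult[symmetric] flip: ennreal_numeral)
  finally show False
    using h_pos pos by (simp add: e_def ennreal_le_iff)
qed

lemma norm_K_bound:
  assumes F: "supp F \<subseteq> \<Omega>" and s: "0 \<le> s" "s \<le> \<sigma>" and t: "1 \<le> t"
  shows "(norm (K F s t y))\<^sup>2 \<le> 5 * h\<^sup>2 * (\<mu> t y * (norm (curl F (g s t y)))\<^sup>2)"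
proof (cases "curl F (g s t y) = 0")
  case True
  then show ?thesis
    by (simp add: K_def Dg_def DV_def)
next
  case False
  then have g: "g s t y \<in> \<Omega>"
    using curl_outside_supp F by blast
  let ?w = "norm (curl F (g s t y))" and ?V = "norm (V s y)"
  have "norm (K F s t y) \<le> t * norm (cross3 (curl F (g s t y)) (V s y))"
    unfolding K_def using length_of_g_in[OF t g] t by (intro norm_Dg_le)
  also have "\<dots> \<le> t * (?w * ?V)"
    using t by (intro mult_left_mono norm_cross3_le) auto
  finally have "(norm (K F s t y))\<^sup>2 \<le> (t * (?w * ?V))\<^sup>2"
    by (intro power_mono) auto
  also have "\<dots> = (t\<^sup>2 * ?V\<^sup>2) * ?w\<^sup>2"
    by (simp add: power_mult_distrib)
  also have "\<dots> \<le> (5 * h\<^sup>2 * \<mu> t y) * ?w\<^sup>2"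
    by (intro mult_right_mono norm_V_bound t g s) auto
  finally show ?thesis
    by (simp add: mult.assoc)
qed

text \<open>The pointwise bound contains \<mu> but not the factor \<open>t\<^sup>2\<close> of the
  Jacobian; supplying it produces the decay \<open>1 / t\<^sup>2\<close>.\<close>

lemma nn_integral_K_le:
  assumes F: "C1 F" "compact (supp F)" "supp F \<subseteq> \<Omega>" and s: "0 \<le> s" "s \<le> \<sigma>" and t: "1 \<le> t"
  shows "(\<integral>\<^sup>+ y. ennreal ((norm (K F s t y))\<^sup>2) \<partial>M)
    \<le> ennreal (5 * h\<^sup>2 / t\<^sup>2) * ennreal (\<integral>y. (norm (curl F y))\<^sup>2 \<partial>M)"
proof -
  let ?\<rho> = "\<lambda>x. (norm (curl F x))\<^sup>2"
  have cont: "continuous_on UNIV ?\<rho>"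
    by (intro continuous_intros continuous_on_curl F)
  have "continuous_on UNIV (\<lambda>y. t\<^sup>2 * \<mu> t y * ?\<rho> (g s t y))"
    unfolding \<mu>_def by (intro continuous_intros continuous_on_compose2[OF continuous_on_curl[OF F(1), of UNIV]]) auto
  then have m: "(\<lambda>y. ennreal (t\<^sup>2 * \<mu> t y * ?\<rho> (g s t y))) \<in> borel_measurable M"
    by (rule measurable_compose[OF continuous_lebesgue_on_measurable measurable_ennreal])
  have "(\<integral>\<^sup>+ y. ennreal ((norm (K F s t y))\<^sup>2) \<partial>M)
      \<le> (\<integral>\<^sup>+ y. ennreal (5 * h\<^sup>2 / t\<^sup>2) * ennreal (t\<^sup>2 * \<mu> t y * ?\<rho> (g s t y)) \<partial>M)"
  proof (rule nn_integral_mono)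
    fix y
    have "(norm (K F s t y))\<^sup>2 \<le> 5 * h\<^sup>2 / t\<^sup>2 * (t\<^sup>2 * \<mu> t y * ?\<rho> (g s t y))"
      using norm_K_bound[OF F(3) s t, of y] t by simp
    then show "ennreal ((norm (K F s t y))\<^sup>2) \<le> ennreal (5 * h\<^sup>2 / t\<^sup>2) * ennreal (t\<^sup>2 * \<mu> t y * ?\<rho> (g s t y))"
      by (subst ennreal_mult'[symmetric]) (auto intro!: ennreal_leI)
  qed
  also have "\<dots> = ennreal (5 * h\<^sup>2 / t\<^sup>2) * (\<integral>\<^sup>+ y. ennreal (t\<^sup>2 * \<mu> t y * ?\<rho> (g s t y)) \<partial>M)"
    by (rule nn_integral_cmult[OF m])
  also have "\<dots> \<le> ennreal (5 * h\<^sup>2 / t\<^sup>2) * ennreal (\<integral>y. ?\<rho> y \<partial>M)"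
    using curl_outside_supp by (intro mult_left_mono nn_integral_g_le[OF cont _ F(2,3) _ t]) auto
  finally show ?thesis .
qed

text \<open>Cauchy-Schwarz in \<open>t\<close> and \<open>y\<close> jointly, with the fourth roots
  of \<open>t\<close> distributed as described at \<open>weight\<close>. Where \<open>K\<close> is
  nonzero, \<open>strip_distance\<close> puts \<open>y\<close> into the slab of the weight, so
  restricting \<open>E\<close> to that slab loses nothing.\<close>

lemma curl_term_bound:
  assumes F: "C1 F" "compact (supp F)" "supp F \<subseteq> \<Omega>" and s: "0 \<le> s" "s \<le> \<sigma>" and T: "1 \<le> T"
    and E: "E \<in> L2 \<Omega>"
    and \<Theta>: "(\<integral>\<^sup>+ (t, y). ennreal (weight E T s t y) \<partial>(lborel \<Otimes>\<^sub>M M)) \<le> ennreal \<Theta>" "0 \<le> \<Theta>"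
  shows "\<bar>\<integral>y. E y \<bullet> integral {1..T} (\<lambda>t. K F s t y) \<partial>M\<bar>
    \<le> sqrt (\<Theta> * (10 * h\<^sup>2 * (\<integral>y. (norm (curl F y))\<^sup>2 \<partial>M)))"
proof -
  define W where "W = (\<integral>y. (norm (curl F y))\<^sup>2 \<partial>M)"
  have W: "0 \<le> W"
    by (simp add: W_def)
  have [measurable]: "E \<in> borel_measurable M"
    using E by (auto simp: L2_def)
  interpret M: sigma_finite_measure M by (rule sigma_finite_M)
  interpret pair_sigma_finite lborel M ..
  let ?N = "lborel \<Otimes>\<^sub>M M"
  have cK: "continuous_on S (\<lambda>t. K F s t y)" for S y
    by (intro continuous_on_K F continuous_intros)
  have [measurable]: "(\<lambda>p. K F s (fst p) (snd p)) \<in> borel_measurable ?N"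
    by (intro continuous_pair_measurable continuous_on_K F continuous_intros)
  define f where "f = (\<lambda>(t, y). ennreal (sqrt (weight E T s t y)))"
  define k where "k = (\<lambda>(t, y). ennreal (sqrt (sqrt t) * norm (K F s t y)) * indicator {1..T} t)"
  have f_m: "f \<in> borel_measurable ?N"
    unfolding f_def case_prod_unfold by measurable
  have [measurable]: "(\<lambda>p. indicator {1..T} (fst p) :: ennreal) \<in> borel_measurable ?N"
    by (intro measurable_compose[OF measurable_fst]) simp
  have k_m: "k \<in> borel_measurable ?N"
    unfolding k_def case_prod_unfold by measurable
  have normG: "ennreal (norm (integral {1..T} (\<lambda>t. K F s t y)))
      \<le> (\<integral>\<^sup>+ t. ennreal (norm (K F s t y)) * indicator {1..T} t \<partial>lborel)" for y
  proof -
    have i: "(\<lambda>t. norm (K F s t y)) integrable_on {1..T}"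
      by (intro integrable_continuous_real continuous_intros cK)
    have "norm (integral {1..T} (\<lambda>t. K F s t y)) \<le> integral {1..T} (\<lambda>t. norm (K F s t y))"
      by (intro integral_norm_bound_integral integrable_continuous_real cK i) simp
    also have "ennreal \<dots> = (\<integral>\<^sup>+ t. ennreal (norm (K F s t y)) * indicator {1..T} t \<partial>lborel)"
      using nn_integral_has_integral_lebesgue'[OF _ integrable_integral[OF i]] by simp
    finally show ?thesis
      by (simp add: ennreal_leI)
  qed
  have "ennreal \<bar>\<integral>y. E y \<bullet> integral {1..T} (\<lambda>t. K F s t y) \<partial>M\<bar> \<le> (\<integral>\<^sup>+ p. f p * k p \<partial>?N)"
  proof -
    \<comment> \<open>A function that is not integrable has integral 0 by convention, so the bound
      holds in that case as well.\<close>
    have "ennreal \<bar>\<integral>y. E y \<bullet> integral {1..T} (\<lambda>t. K F s t y) \<partial>M\<bar>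
        \<le> (\<integral>\<^sup>+ y. ennreal (norm (E y \<bullet> integral {1..T} (\<lambda>t. K F s t y))) \<partial>M)"
      using integral_norm_bound_ennreal[of M "\<lambda>y. E y \<bullet> integral {1..T} (\<lambda>t. K F s t y)"]
      by (cases "integrable M (\<lambda>y. E y \<bullet> integral {1..T} (\<lambda>t. K F s t y))")
         (auto simp: not_integrable_integral_eq)
    also have "\<dots> \<le> (\<integral>\<^sup>+ y. (\<integral>\<^sup>+ t. f (t, y) * k (t, y) \<partial>lborel) \<partial>M)"
    proof (rule nn_integral_mono)
      fix y assume "y \<in> space M"
      have "ennreal (norm (E y \<bullet> integral {1..T} (\<lambda>t. K F s t y)))
          \<le> ennreal (norm (E y)) * ennreal (norm (integral {1..T} (\<lambda>t. K F s t y)))"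
        using Cauchy_Schwarz_ineq2[of "E y"] by (subst ennreal_mult[symmetric]) (auto intro!: ennreal_leI)
      also have "\<dots> \<le> ennreal (norm (E y)) * (\<integral>\<^sup>+ t. ennreal (norm (K F s t y)) * indicator {1..T} t \<partial>lborel)"
        by (intro mult_left_mono normG) simp
      also have "\<dots> = (\<integral>\<^sup>+ t. ennreal (norm (E y)) * (ennreal (norm (K F s t y)) * indicator {1..T} t) \<partial>lborel)"
      proof (rule nn_integral_cmult[symmetric])
        have "(\<lambda>t. norm (K F s t y)) \<in> borel_measurable lborel"
          using borel_measurable_continuous_onI[OF continuous_on_norm[OF cK]] by simp
        then show "(\<lambda>t. ennreal (norm (K F s t y)) * indicator {1..T} t) \<in> borel_measurable lborel"
          by measurable
      qed
      also have "\<dots> \<le> (\<integral>\<^sup>+ t. f (t, y) * k (t, y) \<partial>lborel)"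
      proof (rule nn_integral_mono)
        fix t
        show "ennreal (norm (E y)) * (ennreal (norm (K F s t y)) * indicator {1..T} t) \<le> f (t, y) * k (t, y)"
        proof (cases "t \<in> {1..T} \<and> K F s t y \<noteq> 0")
          case True
          then have "curl F (g s t y) \<noteq> 0"
            by (auto simp: K_def Dg_def DV_def)
          then have "g s t y \<in> \<Omega>"
            using curl_outside_supp F by blast
          then have "t * \<bar>(y - P) \<bullet> e2 - s\<bar> \<le> 2 * h"
            using True s by (intro strip_distance) auto
          then have "sqrt (weight E T s t y) = norm (E y) / sqrt (sqrt t)"
            using True by (auto simp: weight_def real_sqrt_divide)
          then have "f (t, y) * k (t, y) = ennreal (norm (E y) / sqrt (sqrt t)) * ennreal (sqrt (sqrt t) * norm (K F s t y))"
            using True by (simp add: f_def k_def)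
          also have "\<dots> = ennreal (norm (E y) * norm (K F s t y))"
            using True by (subst ennreal_mult[symmetric]) auto
          finally show ?thesis
            using True by (simp add: ennreal_mult)
        qed auto
      qed
      finally show "ennreal (norm (E y \<bullet> integral {1..T} (\<lambda>t. K F s t y)))
          \<le> (\<integral>\<^sup>+ t. f (t, y) * k (t, y) \<partial>lborel)" .
    qed
    also have "\<dots> = (\<integral>\<^sup>+ p. f p * k p \<partial>?N)"
      using f_m k_m by (intro nn_integral_snd borel_measurable_times_ennreal)
    finally show ?thesis .
  qed
  moreover have "(\<integral>\<^sup>+ p. (f p)\<^sup>2 \<partial>?N) \<le> ennreal \<Theta>"
  proof -
    have "(f p)\<^sup>2 = (case p of (t, y) \<Rightarrow> ennreal (weight E T s t y))" for p
      using weight_nonneg by (cases p) (simp add: f_def ennreal_power)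
    then show ?thesis
      using \<Theta> by simp
  qed
  moreover have "(\<integral>\<^sup>+ p. (k p)\<^sup>2 \<partial>?N) \<le> ennreal (10 * h\<^sup>2 * W)"
  proof -
    have "(\<integral>\<^sup>+ p. (k p)\<^sup>2 \<partial>?N) = (\<integral>\<^sup>+ t. (\<integral>\<^sup>+ y. (k (t, y))\<^sup>2 \<partial>M) \<partial>lborel)"
      unfolding power2_eq_square
      by (intro M.nn_integral_fst[symmetric] borel_measurable_times_ennreal k_m)
    also have "\<dots> \<le> (\<integral>\<^sup>+ t. ennreal (5 * h\<^sup>2 * W) * (ennreal (1 / (t * sqrt t)) * indicator {1..T} t) \<partial>lborel)"
    proof (rule nn_integral_mono)
      fix t
      show "(\<integral>\<^sup>+ y. (k (t, y))\<^sup>2 \<partial>M) \<le> ennreal (5 * h\<^sup>2 * W) * (ennreal (1 / (t * sqrt t)) * indicator {1..T} t)"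
      proof (cases "t \<in> {1..T}")
        case True
        then have "(k (t, y))\<^sup>2 = ennreal (sqrt t) * ennreal ((norm (K F s t y))\<^sup>2)" for y
          by (simp add: k_def ennreal_power power_mult_distrib ennreal_mult)
        then have "(\<integral>\<^sup>+ y. (k (t, y))\<^sup>2 \<partial>M) = (\<integral>\<^sup>+ y. ennreal (sqrt t) * ennreal ((norm (K F s t y))\<^sup>2) \<partial>M)"
          by simp
        also have "\<dots> = ennreal (sqrt t) * (\<integral>\<^sup>+ y. ennreal ((norm (K F s t y))\<^sup>2) \<partial>M)"
          by (intro nn_integral_cmult measurable_compose[OF continuous_lebesgue_on_measurable measurable_ennreal]
              continuous_intros continuous_on_K F)
        also have "\<dots> \<le> ennreal (sqrt t) * (ennreal (5 * h\<^sup>2 / t\<^sup>2) * ennreal W)"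
          unfolding W_def using True by (intro mult_left_mono nn_integral_K_le F s) auto
        also have "\<dots> = ennreal (sqrt t * (5 * h\<^sup>2 / t\<^sup>2 * W))"
          using True W by (subst ennreal_mult, simp, simp)+ simp
        also have "sqrt t * (5 * h\<^sup>2 / t\<^sup>2 * W) = 5 * h\<^sup>2 * W * (1 / (t * sqrt t))"
        proof -
          have "sqrt t * sqrt t = t" "sqrt t \<noteq> 0" "t \<noteq> 0"
            using True by auto
          then show ?thesis
            by (simp add: field_simps power2_eq_square)
        qed
        also have "ennreal \<dots> = ennreal (5 * h\<^sup>2 * W) * (ennreal (1 / (t * sqrt t)) * indicator {1..T} t)"
          using True W by (subst ennreal_mult) auto
        finally show ?thesis .
      qed (simp add: k_def)
    qed
    also have "\<dots> = ennreal (5 * h\<^sup>2 * W) * (\<integral>\<^sup>+ t. ennreal (1 / (t * sqrt t)) * indicator {1..T} t \<partial>lborel)"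
      by (rule nn_integral_cmult) measurable
    also have "\<dots> \<le> ennreal (5 * h\<^sup>2 * W) * ennreal 2"
      using nn_integral_three_halves_le[OF T] by (intro mult_left_mono) auto
    also have "\<dots> = ennreal (10 * h\<^sup>2 * W)"
      using W by (subst ennreal_mult[symmetric]) (auto simp: algebra_simps)
    finally show ?thesis .
  qed
  ultimately show ?thesis
    unfolding W_def[symmetric] using \<Theta> W by (intro Cauchy_Schwarz_bound[OF f_m k_m]) auto
qed

text \<open>The end term lives on the slab belonging to \<open>t = T\<close>, the thinnest one,
  which is contained in all slabs with \<open>t\<close> between 1 and \<open>T\<close>. On it the
  weight is therefore active throughout and integrates to at least (T - 1) / sqrt T times the square
  of \<open>E\<close>. So the bound \<Theta> also forces \<open>E\<close> to be small there, by a
  factor that tends to 0.\<close>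

lemma remainder_bound:
  assumes F: "C1 F" "compact (supp F)" "supp F \<subseteq> \<Omega>" and s: "0 \<le> s" "s \<le> \<sigma>" and T: "1 < T"
    and E: "E \<in> L2 \<Omega>"
    and \<Theta>: "(\<integral>\<^sup>+ (t, y). ennreal (weight E T s t y) \<partial>(lborel \<Otimes>\<^sub>M M)) \<le> ennreal \<Theta>" "0 \<le> \<Theta>"
  shows "\<bar>\<integral>y. E y \<bullet> Dg T y (F (g s T y)) \<partial>M\<bar>
    \<le> sqrt (\<Theta> * sqrt T / (T - 1) * (\<integral>y. (norm (F y))\<^sup>2 \<partial>M))"
proof -
  define f where "f y = ennreal (if T * \<bar>(y - P) \<bullet> e2 - s\<bar> \<le> 2 * h then norm (E y) else 0)" for y
  define k where "k y = ennreal (T * norm (F (g s T y)))" for y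
  have cF: "continuous_on UNIV F"
    by (rule C1_continuous_on[OF F(1)])
  have cont: "continuous_on UNIV (\<lambda>y. F (g s T y))"
    by (intro continuous_on_compose2[OF cF] continuous_intros) auto
  have [measurable]: "E \<in> borel_measurable M"
    using E by (auto simp: L2_def)
  have [measurable]: "(\<lambda>y. F (g s T y)) \<in> borel_measurable M"
    by (rule continuous_lebesgue_on_measurable[OF cont])
  have f_m[measurable]: "f \<in> borel_measurable M"
    unfolding f_def by measurable
  have k_m[measurable]: "k \<in> borel_measurable M"
    unfolding k_def by measurable
  interpret M: sigma_finite_measure M by (rule sigma_finite_M)
  interpret pair_sigma_finite lborel M ..
  define c where "c = (T - 1) / sqrt T"
  have c: "0 < c"
    using T by (simp add: c_def)
  have f2: "(\<integral>\<^sup>+ y. (f y)\<^sup>2 \<partial>M) \<le> ennreal (\<Theta> * sqrt T / (T - 1))"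
  proof -
    have "ennreal c * (\<integral>\<^sup>+ y. (f y)\<^sup>2 \<partial>M)
        = (\<integral>\<^sup>+ t. ennreal (1 / sqrt T) * (\<integral>\<^sup>+ y. (f y)\<^sup>2 \<partial>M) * indicator {1..T} t \<partial>lborel)"
    proof -
      have "ennreal c = ennreal (1 / sqrt T) * ennreal (T - 1)"
        using T by (simp add: c_def ennreal_mult[symmetric])
      then show ?thesis
        using T by (subst nn_integral_cmult_indicator) (auto simp: ac_simps)
    qed
    also have "\<dots> = (\<integral>\<^sup>+ t. (\<integral>\<^sup>+ y. ennreal (1 / sqrt T) * indicator {1..T} t * (f y)\<^sup>2 \<partial>M) \<partial>lborel)"
      by (subst nn_integral_cmult) (auto simp: ac_simps)
    also have "\<dots> \<le> (\<integral>\<^sup>+ t. (\<integral>\<^sup>+ y. ennreal (weight E T s t y) \<partial>M) \<partial>lborel)"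
    proof (intro nn_integral_mono)
      fix t y
      show "ennreal (1 / sqrt T) * indicator {1..T} t * (f y)\<^sup>2 \<le> ennreal (weight E T s t y)"
      proof (cases "t \<in> {1..T} \<and> T * \<bar>(y - P) \<bullet> e2 - s\<bar> \<le> 2 * h")
        case True
        have "t * \<bar>(y - P) \<bullet> e2 - s\<bar> \<le> T * \<bar>(y - P) \<bullet> e2 - s\<bar>"
          using True by (intro mult_right_mono) auto
        then have w: "weight E T s t y = (norm (E y))\<^sup>2 / sqrt t"
          using True by (auto simp: weight_def)
        have "ennreal (1 / sqrt T) * indicator {1..T} t * (f y)\<^sup>2 = ennreal ((norm (E y))\<^sup>2 / sqrt T)"
          using True T by (simp add: f_def ennreal_power ennreal_mult[symmetric])
        also have "\<dots> \<le> ennreal (weight E T s t y)"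
          unfolding w using True by (intro ennreal_leI divide_left_mono) auto
        finally show ?thesis .
      qed (auto simp: f_def)
    qed
    also have "\<dots> = (\<integral>\<^sup>+ (t, y). ennreal (weight E T s t y) \<partial>(lborel \<Otimes>\<^sub>M M))"
      by (subst M.nn_integral_fst[symmetric]) (auto simp: case_prod_unfold)
    also have "\<dots> \<le> ennreal \<Theta>"
      by (rule \<Theta>)
    finally have "ennreal (1 / c) * (ennreal c * (\<integral>\<^sup>+ y. (f y)\<^sup>2 \<partial>M)) \<le> ennreal (1 / c) * ennreal \<Theta>"
      by (intro mult_left_mono) auto
    moreover have "ennreal (1 / c) * (ennreal c * (\<integral>\<^sup>+ y. (f y)\<^sup>2 \<partial>M)) = (\<integral>\<^sup>+ y. (f y)\<^sup>2 \<partial>M)"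
      using c by (simp add: mult.assoc[symmetric] ennreal_mult[symmetric])
    moreover have "ennreal (1 / c) * ennreal \<Theta> = ennreal (\<Theta> * sqrt T / (T - 1))"
      using c \<Theta> T by (subst ennreal_mult[symmetric]) (auto simp: c_def ac_simps)
    ultimately show ?thesis by simp
  qed
  have k2: "(\<integral>\<^sup>+ y. (k y)\<^sup>2 \<partial>M) \<le> ennreal (\<integral>y. (norm (F y))\<^sup>2 \<partial>M)"
  proof -
    have "(\<integral>\<^sup>+ y. (k y)\<^sup>2 \<partial>M) \<le> (\<integral>\<^sup>+ y. ennreal (T\<^sup>2 * \<mu> T y * (norm (F (g s T y)))\<^sup>2) \<partial>M)"
    proof (rule nn_integral_mono)
      fix y
      have "1 \<le> \<mu> T y"
        using \<eta>_nonneg T by (simp add: \<mu>_def)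
      then have "T\<^sup>2 * 1 * (norm (F (g s T y)))\<^sup>2 \<le> T\<^sup>2 * \<mu> T y * (norm (F (g s T y)))\<^sup>2"
        by (intro mult_right_mono mult_left_mono) auto
      then show "(k y)\<^sup>2 \<le> ennreal (T\<^sup>2 * \<mu> T y * (norm (F (g s T y)))\<^sup>2)"
        using T by (simp add: k_def ennreal_power power_mult_distrib ennreal_leI)
    qed
    also have "\<dots> \<le> ennreal (\<integral>y. (norm (F y))\<^sup>2 \<partial>M)"
      using T notin_supp by (intro nn_integral_g_le[OF _ _ F(2,3)] continuous_intros cF) auto
    finally show ?thesis .
  qed
  have "ennreal \<bar>\<integral>y. E y \<bullet> Dg T y (F (g s T y)) \<partial>M\<bar> \<le> (\<integral>\<^sup>+ y. f y * k y \<partial>M)"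
  proof -
    have "ennreal \<bar>\<integral>y. E y \<bullet> Dg T y (F (g s T y)) \<partial>M\<bar>
        \<le> (\<integral>\<^sup>+ y. ennreal (norm (E y \<bullet> Dg T y (F (g s T y)))) \<partial>M)"
      using integral_norm_bound_ennreal[of M "\<lambda>y. E y \<bullet> Dg T y (F (g s T y))"]
      by (cases "integrable M (\<lambda>y. E y \<bullet> Dg T y (F (g s T y)))")
         (auto simp: not_integrable_integral_eq)
    also have "\<dots> \<le> (\<integral>\<^sup>+ y. f y * k y \<partial>M)"
    proof (rule nn_integral_mono)
      fix y
      show "ennreal (norm (E y \<bullet> Dg T y (F (g s T y)))) \<le> f y * k y"
      proof (cases "F (g s T y) = 0")
        case False
        then have gy: "g s T y \<in> \<Omega>"
          using notin_supp F(3) by blast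
        have "T * \<bar>(y - P) \<bullet> e2 - s\<bar> \<le> 2 * h"
          using T s gy by (intro strip_distance) auto
        then have "f y * k y = ennreal (norm (E y) * (T * norm (F (g s T y))))"
          using T by (simp add: f_def k_def ennreal_mult)
        moreover have "norm (E y \<bullet> Dg T y (F (g s T y))) \<le> norm (E y) * (T * norm (F (g s T y)))"
          using Cauchy_Schwarz_ineq2[of "E y" "Dg T y (F (g s T y))"] length_of_g_in[of T s y] T gy
          by (intro order_trans[OF _ mult_left_mono[OF norm_Dg_le]]) auto
        ultimately show ?thesis
          by (simp add: ennreal_leI)
      qed (simp add: Dg_def DV_def)
    qed
    finally show ?thesis .
  qed
  then show ?thesis
    using f2 k2 T \<Theta> by (intro Cauchy_Schwarz_bound[OF f_m k_m]) auto
qed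

text \<open>Pairing \<open>E\<close> with the homotopy formula removes the gradient; the end term
  vanishes in the limit of large \<open>T\<close>, and the curl term has a bound free of
  \<open>T\<close>.\<close>

lemma inner_test_field_bound:
  assumes E: "E \<in> L2 \<Omega>" "weak_div_free \<Omega> E" and pos: "0 < (\<integral>y. (norm (E y))\<^sup>2 \<partial>M)"
    and F: "F \<in> test_fun \<Omega>"
  shows "\<bar>\<integral>y. E y \<bullet> F y \<partial>M\<bar>
    \<le> sqrt (360 * (h * L) * (\<integral>y. (norm (E y))\<^sup>2 \<partial>M) * (\<integral>y. (norm (curl F y))\<^sup>2 \<partial>M))"
proof (cases "\<exists>x. F x \<noteq> 0")
  case False
  then show ?thesis
    using h_pos L_pos by simp
next
  case True
  then obtain x0 where x0: "F x0 \<noteq> 0" ..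
  define e where "e = (\<integral>y. (norm (E y))\<^sup>2 \<partial>M)"
  define W where "W = (\<integral>y. (norm (curl F y))\<^sup>2 \<partial>M)"
  define N where "N = (\<integral>y. (norm (F y))\<^sup>2 \<partial>M)"
  define \<Theta> where "\<Theta> = 9 * h / \<sigma> * e"
  have sF: "smooth F" and F': "compact (supp F)" "supp F \<subseteq> \<Omega>"
    using F by (auto simp: test_fun_def)
  have F1: "C1 F"
    by (rule smooth_C1[OF sF])
  \<comment> \<open>The squared norm of \<open>F\<close> serves as the mollifying bump in
    \<open>weak_div_free_C1\<close>.\<close>
  have r: "smooth (\<lambda>x. F x \<bullet> F x)" "compact (supp (\<lambda>x. F x \<bullet> F x))"
    by (rule smooth_inner[OF sF sF], rule compact_supp[OF F'(1)]) (simp add: notin_supp)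
  have "e > 0"
    using pos by (simp add: e_def)
  \<comment> \<open>9 * 10 * 4 = 360: the choice of \<sigma> turns h^3 / \<sigma> into 4 h
    L.\<close>
  then have \<Theta>: "0 \<le> \<Theta>" "\<Theta> * (10 * h\<^sup>2 * W) = 360 * (h * L) * e * W"
    using h_pos \<sigma>_bounds(1) L_pos unfolding \<Theta>_def
    by (simp, simp add: \<sigma>_def field_simps power2_eq_square)
  have bound: "\<bar>\<integral>y. E y \<bullet> F y \<partial>M\<bar> \<le> sqrt (\<Theta> * N * inverse (real (Suc n))) + sqrt (\<Theta> * (10 * h\<^sup>2 * W))" for n
  proof -
    \<comment> \<open>A perfect square keeps sqrt T rational, and sqrt T / (T - 1) = (n + 2) / ((n +
      1) (n + 3)) is below 1 / (n + 1). The line \<open>s\<close> depends on \<open>T\<close>, but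
      its bound \<Theta> does not.\<close>
    define T where "T = (real n + 2)\<^sup>2"
    have T: "1 < T"
      by (simp add: T_def power2_eq_square field_simps add_pos_nonneg)
    obtain s where s: "0 \<le> s" "s \<le> \<sigma>"
      "(\<integral>\<^sup>+ (t, y). ennreal (weight E T s t y) \<partial>(lborel \<Otimes>\<^sub>M M)) \<le> ennreal \<Theta>"
      using exists_good_line[OF E(1) less_imp_le[OF T] pos] unfolding \<Theta>_def e_def by metis
    let ?A = "\<lambda>y. Dg T y (F (g s T y))" and ?G = "\<lambda>y. integral {1..T} (\<lambda>t. K F s t y)"
    have cF: "continuous_on UNIV F"
      by (rule C1_continuous_on[OF F1])
    have cA: "continuous_on UNIV ?A"
      by (intro continuous_intros continuous_on_compose2[OF cF]) auto
    have cgrad: "continuous_on UNIV (grad (\<Psi> F s T))"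
      by (intro continuous_on_grad \<Psi>_C1 F1)
    have eq: "F y = ?A y - grad (\<Psi> F s T) y - ?G y" for y
      by (rule homotopy_formula[OF F1 less_imp_le[OF T]])
    have Geq: "?G = (\<lambda>y. ?A y - grad (\<Psi> F s T) y - F y)"
      using eq by (simp add: algebra_simps fun_eq_iff)
    \<comment> \<open>Continuity of the integral term is read off from the homotopy formula, all
      other terms of which are continuous.\<close>
    have cG: "continuous_on UNIV ?G"
      by (rule back_subst[of "continuous_on UNIV", OF _ Geq[symmetric]])
         (intro continuous_on_diff cA cgrad cF)
    have int: "integrable M (\<lambda>y. E y \<bullet> H y)" if "continuous_on UNIV H" for H
      by (rule integrable_inner_continuous[OF bounded_\<Omega> open_\<Omega> E(1) that])
    have "(\<integral>y. E y \<bullet> F y \<partial>M) = (\<integral>y. E y \<bullet> ?A y - E y \<bullet> grad (\<Psi> F s T) y - E y \<bullet> ?G y \<partial>M)"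
      by (subst eq) (simp add: inner_diff_right)
    also have "\<dots> = (\<integral>y. E y \<bullet> ?A y \<partial>M) - (\<integral>y. E y \<bullet> grad (\<Psi> F s T) y \<partial>M) - (\<integral>y. E y \<bullet> ?G y \<partial>M)"
      using int[OF cA] int[OF cgrad] int[OF cG] by simp
    also have "(\<integral>y. E y \<bullet> grad (\<Psi> F s T) y \<partial>M) = 0"
      using x0 by (intro weak_div_free_C1[OF bounded_\<Omega> open_\<Omega> E r _ _ \<Psi>_C1(1)[OF F1]
          \<Psi>_support[OF F' s(1,2) less_imp_le[OF T]], of x0]) auto
    finally have "\<bar>\<integral>y. E y \<bullet> F y \<partial>M\<bar> \<le> \<bar>\<integral>y. E y \<bullet> ?A y \<partial>M\<bar> + \<bar>\<integral>y. E y \<bullet> ?G y \<partial>M\<bar>"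
      by linarith
    also have "\<dots> \<le> sqrt (\<Theta> * sqrt T / (T - 1) * N) + sqrt (\<Theta> * (10 * h\<^sup>2 * W))"
      unfolding N_def W_def
      using T s \<Theta> by (intro add_mono remainder_bound curl_term_bound F1 F' E) auto
    also have "\<Theta> * sqrt T / (T - 1) * N \<le> \<Theta> * N * inverse (real (Suc n))"
    proof -
      have "sqrt T = real n + 2"
        by (simp add: T_def)
      moreover have "(real n + 2) / (T - 1) \<le> inverse (real (Suc n))"
        using T by (simp add: T_def field_simps power2_eq_square)
      ultimately have "sqrt T / (T - 1) \<le> inverse (real (Suc n))"
        by simp
      moreover have "0 \<le> N"
        by (simp add: N_def)
      ultimately have "\<Theta> * N * (sqrt T / (T - 1)) \<le> \<Theta> * N * inverse (real (Suc n))"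
        using \<Theta> by (intro mult_left_mono) auto
      then show ?thesis
        by (simp add: ac_simps)
    qed
    finally show ?thesis
      by simp
  qed
  have "(\<lambda>n. sqrt (\<Theta> * N * inverse (real (Suc n))) + sqrt (\<Theta> * (10 * h\<^sup>2 * W)))
      \<longlonglongrightarrow> sqrt (\<Theta> * N * 0) + sqrt (\<Theta> * (10 * h\<^sup>2 * W))"
    by (intro tendsto_intros LIMSEQ_inverse_real_of_nat)
  then have "\<bar>\<integral>y. E y \<bullet> F y \<partial>M\<bar> \<le> sqrt (\<Theta> * N * 0) + sqrt (\<Theta> * (10 * h\<^sup>2 * W))"
    by (rule LIMSEQ_le_const) (use bound in blast)
  then show ?thesis
    unfolding \<Theta>(2) e_def[symmetric] W_def[symmetric] by simp
qed

end

section \<open>Eigenvalue and perimeter bounds\<close>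

lemma convex_combination_3:
  assumes "convex S" "x \<in> S" "y \<in> S" "z \<in> S" "0 \<le> u" "0 \<le> v" "0 \<le> w" "u + v + w = 1"
  shows "u *\<^sub>R x + v *\<^sub>R y + w *\<^sub>R z \<in> S"
proof -
  have "u *\<^sub>R x + v *\<^sub>R y + w *\<^sub>R z \<in> convex hull {x, y, z}"
    unfolding convex_hull_3 using assms by blast
  also have "\<dots> \<subseteq> S"
    using assms by (intro hull_minimal) auto
  finally show ?thesis .
qed

section \<open>Square integrable fields\<close>

lemma continuous_L2:
  assumes "bounded \<Omega>" "open \<Omega>" and F: "continuous_on UNIV F"
  shows "F \<in> L2 \<Omega>"
proof -
  interpret finite_measure "lebesgue_on \<Omega>"
    using assms by (intro finite_measure_lebesgue_on bounded_open_lmeasurable)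
  have [measurable]: "F \<in> borel_measurable (lebesgue_on \<Omega>)"
    by (rule continuous_lebesgue_on_measurable[OF F])
  obtain B where B: "\<And>x. x \<in> \<Omega> \<Longrightarrow> norm (F x) \<le> B"
    using continuous_bounded_on_bounded[OF assms(1) F] by metis
  have "integrable (lebesgue_on \<Omega>) (\<lambda>x. (norm (F x))\<^sup>2)"
    using B by (intro integrable_const_bound[of _ "B\<^sup>2"] AE_I2) (auto simp: space_restrict_space intro: power_mono)
  then show ?thesis
    by (simp add: L2_def)
qed

lemma L2_diff:
  assumes "f \<in> L2 \<Omega>" "g \<in> L2 \<Omega>"
  shows "(\<lambda>x. f x - g x) \<in> L2 \<Omega>"
proof -
  have [measurable]: "f \<in> borel_measurable (lebesgue_on \<Omega>)" "g \<in> borel_measurable (lebesgue_on \<Omega>)"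
    and i: "integrable (lebesgue_on \<Omega>) (\<lambda>x. (norm (f x))\<^sup>2)" "integrable (lebesgue_on \<Omega>) (\<lambda>x. (norm (g x))\<^sup>2)"
    using assms by (auto simp: L2_def)
  have "integrable (lebesgue_on \<Omega>) (\<lambda>x. (norm (f x - g x))\<^sup>2)"
  proof (rule Bochner_Integration.integrable_bound)
    show "integrable (lebesgue_on \<Omega>) (\<lambda>x. 2 * (norm (f x))\<^sup>2 + 2 * (norm (g x))\<^sup>2)"
      using i by simp
    show "AE x in lebesgue_on \<Omega>. norm ((norm (f x - g x))\<^sup>2) \<le> norm (2 * (norm (f x))\<^sup>2 + 2 * (norm (g x))\<^sup>2)"
    proof (rule AE_I2)
      fix x
      have "(norm (f x - g x))\<^sup>2 + (norm (f x + g x))\<^sup>2 = 2 * (norm (f x))\<^sup>2 + 2 * (norm (g x))\<^sup>2"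
        unfolding power2_norm_eq_inner by (simp add: inner_diff_left inner_diff_right inner_add_left inner_add_right)
      then have "(norm (f x - g x))\<^sup>2 \<le> 2 * (norm (f x))\<^sup>2 + 2 * (norm (g x))\<^sup>2"
        using zero_le_power2[of "norm (f x + g x)"] by linarith
      then show "norm ((norm (f x - g x))\<^sup>2) \<le> norm (2 * (norm (f x))\<^sup>2 + 2 * (norm (g x))\<^sup>2)"
        by simp
    qed
  qed measurable
  then show ?thesis
    by (simp add: L2_def)
qed

lemma L2_Cauchy_Schwarz:
  assumes "f \<in> L2 \<Omega>" "g \<in> L2 \<Omega>"
  shows "integrable (lebesgue_on \<Omega>) (\<lambda>x. f x \<bullet> g x)"
    and "\<bar>\<integral>x. f x \<bullet> g x \<partial>lebesgue_on \<Omega>\<bar>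
      \<le> sqrt ((\<integral>x. (norm (f x))\<^sup>2 \<partial>lebesgue_on \<Omega>) * (\<integral>x. (norm (g x))\<^sup>2 \<partial>lebesgue_on \<Omega>))"
proof -
  have [measurable]: "f \<in> borel_measurable (lebesgue_on \<Omega>)" "g \<in> borel_measurable (lebesgue_on \<Omega>)"
    and i: "integrable (lebesgue_on \<Omega>) (\<lambda>x. (norm (f x))\<^sup>2)" "integrable (lebesgue_on \<Omega>) (\<lambda>x. (norm (g x))\<^sup>2)"
    using assms by (auto simp: L2_def)
  show fg: "integrable (lebesgue_on \<Omega>) (\<lambda>x. f x \<bullet> g x)"
  proof (rule Bochner_Integration.integrable_bound)
    show "integrable (lebesgue_on \<Omega>) (\<lambda>x. (norm (f x))\<^sup>2 + (norm (g x))\<^sup>2)"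
      using i by simp
    show "AE x in lebesgue_on \<Omega>. norm (f x \<bullet> g x) \<le> norm ((norm (f x))\<^sup>2 + (norm (g x))\<^sup>2)"
    proof (rule AE_I2)
      fix x
      have "\<bar>f x \<bullet> g x\<bar> \<le> norm (f x) * norm (g x)"
        by (rule Cauchy_Schwarz_ineq2)
      also have "\<dots> \<le> (norm (f x))\<^sup>2 + (norm (g x))\<^sup>2"
        using sum_squares_bound[of "norm (f x)" "norm (g x)"] mult_nonneg_nonneg[OF norm_ge_zero[of "f x"] norm_ge_zero[of "g x"]]
        by linarith
      finally show "norm (f x \<bullet> g x) \<le> norm ((norm (f x))\<^sup>2 + (norm (g x))\<^sup>2)"
        by simp
    qed
  qed measurable
  have "ennreal \<bar>\<integral>x. f x \<bullet> g x \<partial>lebesgue_on \<Omega>\<bar> \<le> (\<integral>\<^sup>+ x. ennreal (norm (f x \<bullet> g x)) \<partial>lebesgue_on \<Omega>)"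
    using integral_norm_bound_ennreal[OF fg] by simp
  also have "\<dots> \<le> (\<integral>\<^sup>+ x. ennreal (norm (f x)) * ennreal (norm (g x)) \<partial>lebesgue_on \<Omega>)"
    using Cauchy_Schwarz_ineq2 by (intro nn_integral_mono) (auto simp: ennreal_mult[symmetric] intro!: ennreal_leI)
  finally show "\<bar>\<integral>x. f x \<bullet> g x \<partial>lebesgue_on \<Omega>\<bar>
      \<le> sqrt ((\<integral>x. (norm (f x))\<^sup>2 \<partial>lebesgue_on \<Omega>) * (\<integral>x. (norm (g x))\<^sup>2 \<partial>lebesgue_on \<Omega>))"
    using i by (intro Cauchy_Schwarz_bound[of "\<lambda>x. ennreal (norm (f x))" _ "\<lambda>x. ennreal (norm (g x))"])
      (auto simp: ennreal_power nn_integral_eq_integral)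
qed

lemma L2_norm_diff_le:
  assumes f: "f \<in> L2 \<Omega>" and g: "g \<in> L2 \<Omega>"
  shows "sqrt (\<integral>x. (norm (g x))\<^sup>2 \<partial>lebesgue_on \<Omega>)
    \<le> sqrt (\<integral>x. (norm (f x))\<^sup>2 \<partial>lebesgue_on \<Omega>) + sqrt (\<integral>x. (norm (f x - g x))\<^sup>2 \<partial>lebesgue_on \<Omega>)"
proof -
  let ?I = "\<lambda>f. \<integral>x. (norm (f x))\<^sup>2 \<partial>lebesgue_on \<Omega>"
  let ?d = "\<lambda>x. f x - g x"
  have d: "?d \<in> L2 \<Omega>"
    by (rule L2_diff[OF f g])
  have i: "integrable (lebesgue_on \<Omega>) (\<lambda>x. (norm (f x))\<^sup>2)" "integrable (lebesgue_on \<Omega>) (\<lambda>x. (norm (?d x))\<^sup>2)"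
    "integrable (lebesgue_on \<Omega>) (\<lambda>x. f x \<bullet> ?d x)"
    using f d L2_Cauchy_Schwarz(1)[OF f d] by (auto simp: L2_def)
  have eq: "(norm (g x))\<^sup>2 = (norm (f x))\<^sup>2 - 2 * (f x \<bullet> ?d x) + (norm (?d x))\<^sup>2" for x
    unfolding power2_norm_eq_inner by (simp add: inner_diff_left inner_diff_right inner_commute)
  have "?I g = ?I f - 2 * (\<integral>x. f x \<bullet> ?d x \<partial>lebesgue_on \<Omega>) + ?I ?d"
    unfolding eq using i by simp
  also have "\<dots> \<le> ?I f + 2 * sqrt (?I f * ?I ?d) + ?I ?d"
    using L2_Cauchy_Schwarz(2)[OF f d] by simp
  also have "\<dots> = (sqrt (?I f) + sqrt (?I ?d))\<^sup>2"
    by (simp add: power2_sum real_sqrt_mult)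
  finally show ?thesis
    by (intro real_le_lsqrt) auto
qed

context thin_frame
begin

text \<open>\<open>E\<close> is paired with itself, one copy being replaced by a test field
  \<open>F\<close> close to it in H(curl), so that \<open>inner_test_field_bound\<close> applies. A
  factor \<open>sqrt e\<close> cancels and the distance of \<open>F\<close> from \<open>E\<close>
  tends to 0.\<close>

lemma maxwell_eigenvalue_ge: "ereal (1 / (360 * (h * L))) \<le> maxwell_eigenvalue \<Omega>"
  unfolding maxwell_eigenvalue_def
proof (rule INF_greatest)
  fix E assume "E \<in> {E \<in> maxwell_space \<Omega>. \<not> (AE x in M. E x = 0)}"
  then have E: "E \<in> H0curl \<Omega>" "weak_div_free \<Omega> E" and nz: "\<not> (AE x in M. E x = 0)"
    by (auto simp: maxwell_space_def)
  define w where "w = weak_curl \<Omega> E"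
  have EL: "E \<in> L2 \<Omega>" and "\<exists>w. w \<in> L2 \<Omega> \<and> is_weak_curl \<Omega> E w"
    using E(1) by (auto simp: H0curl_def Hcurl_def)
  then have wL: "w \<in> L2 \<Omega>"
    unfolding w_def weak_curl_def by (metis (mono_tags, lifting) someI_ex)
  define e where "e = (\<integral>x. (norm (E x))\<^sup>2 \<partial>M)"
  define c where "c = (\<integral>x. (norm (w x))\<^sup>2 \<partial>M)"
  have "e \<noteq> 0"
  proof
    assume "e = 0"
    then have "AE x in M. (norm (E x))\<^sup>2 = 0"
      using EL by (subst integral_nonneg_eq_0_iff_AE[symmetric]) (auto simp: L2_def e_def)
    with nz show False by simp
  qed
  moreover have "0 \<le> e" "0 \<le> c"
    by (simp_all add: e_def c_def)
  ultimately have e: "0 < e" by simp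
  define k where "k = sqrt (360 * (h * L))"
  have k: "0 < k"
    using h_pos L_pos by (simp add: k_def)
  have bnd: "sqrt e \<le> k * (sqrt c + \<epsilon>) + \<epsilon>" if \<epsilon>: "0 < \<epsilon>" for \<epsilon>
  proof -
    obtain F where F: "F \<in> test_fun \<Omega>"
      and near: "sqrt ((\<integral>x. (norm (E x - F x))\<^sup>2 \<partial>M) + (\<integral>x. (norm (w x - curl F x))\<^sup>2 \<partial>M)) < \<epsilon>"
      using E(1) \<epsilon> unfolding H0curl_def w_def by blast
    let ?a = "\<integral>x. (norm (E x - F x))\<^sup>2 \<partial>M" and ?b = "\<integral>x. (norm (w x - curl F x))\<^sup>2 \<partial>M"
    have ab: "0 \<le> ?a" "0 \<le> ?b"
      by simp_all
    then have a: "sqrt ?a \<le> \<epsilon>" and b: "sqrt ?b \<le> \<epsilon>"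
      using near by (smt (verit) real_sqrt_le_iff)+
    have F1: "C1 F"
      using F by (auto simp: test_fun_def intro: smooth_C1)
    have FL: "F \<in> L2 \<Omega>" and curlL: "curl F \<in> L2 \<Omega>"
      by (intro continuous_L2 bounded_\<Omega> open_\<Omega> C1_continuous_on continuous_on_curl F1)+
    have "e = (\<integral>x. E x \<bullet> F x + E x \<bullet> (E x - F x) \<partial>M)"
      unfolding e_def power2_norm_eq_inner by (simp add: inner_diff_right)
    also have "\<dots> = (\<integral>x. E x \<bullet> F x \<partial>M) + (\<integral>x. E x \<bullet> (E x - F x) \<partial>M)"
      by (intro Bochner_Integration.integral_add L2_Cauchy_Schwarz(1) EL FL L2_diff)
    also have "\<dots> \<le> sqrt (360 * (h * L) * e * (\<integral>y. (norm (curl F y))\<^sup>2 \<partial>M)) + sqrt (e * ?a)"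
      using inner_test_field_bound[OF EL E(2) _ F] e L2_Cauchy_Schwarz(2)[OF EL L2_diff[OF EL FL]]
      unfolding e_def by linarith
    also have "\<dots> = sqrt e * (k * sqrt (\<integral>y. (norm (curl F y))\<^sup>2 \<partial>M) + sqrt ?a)"
      by (simp add: k_def real_sqrt_mult algebra_simps)
    also have "\<dots> \<le> sqrt e * (k * (sqrt c + \<epsilon>) + \<epsilon>)"
    proof -
      have "sqrt (\<integral>y. (norm (curl F y))\<^sup>2 \<partial>M) \<le> sqrt c + \<epsilon>"
        using L2_norm_diff_le[OF wL curlL] b unfolding c_def by linarith
      then show ?thesis
        using k a e by (intro mult_left_mono add_mono) auto
    qed
    finally have "sqrt e * sqrt e \<le> sqrt e * (k * (sqrt c + \<epsilon>) + \<epsilon>)"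
      using e by simp
    then show ?thesis
      by (rule mult_left_le_imp_le) (use e in simp)
  qed
  have "sqrt e \<le> k * sqrt c"
  proof (rule field_le_epsilon)
    fix \<delta> :: real assume "0 < \<delta>"
    then have "sqrt e \<le> k * (sqrt c + \<delta> / (k + 1)) + \<delta> / (k + 1)"
      using k by (intro bnd) simp
    moreover have "\<delta> / (k + 1) * (k + 1) = \<delta>"
      using k by simp
    ultimately show "sqrt e \<le> k * sqrt c + \<delta>"
      by argo
  qed
  then have "(sqrt e)\<^sup>2 \<le> (k * sqrt c)\<^sup>2"
    using e by (intro power_mono) auto
  then have "e \<le> 360 * (h * L) * c"
    using e \<open>0 \<le> c\<close> h_pos L_pos by (simp add: power_mult_distrib k_def)
  then have "1 / (360 * (h * L)) \<le> c / e"
    using e h_pos L_pos by (simp add: field_simps)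
  then show "ereal (1 / (360 * (h * L)))
      \<le> ereal ((\<integral>x. (norm (weak_curl \<Omega> E x))\<^sup>2 \<partial>M) / (\<integral>x. (norm (E x))\<^sup>2 \<partial>M))"
    by (simp add: c_def e_def w_def)
qed

text \<open>
  The test field is \<open>arctan ((x - b) \<bullet> n / \<epsilon>) / 2\<close> times the unit normal \<open>n\<close> of the
  plane of the frame, cut off outside \<open>\<Omega>\<close>: it jumps across a parallelogram inside \<open>\<Omega>\<close> of area
  comparable to \<open>h * L\<close>.
\<close>

lemma perimeter_ge: "ereal (h * L / 64) \<le> perimeter \<Omega>"
proof -
  define n where "n = cross3 e1 e2"
  have n: "n \<bullet> n = 1" "e1 \<bullet> n = 0" "e2 \<bullet> n = 0"
    using norm_cross[of e1 e2] unit norm_e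
    by (auto simp: n_def dot_cross_self power2_norm_eq_inner)
  then have norm_n: "norm n = 1"
    by (simp add: norm_eq_1)
  obtain r where r: "P + r *\<^sub>R e1 + h *\<^sub>R e2 \<in> closure \<Omega>"
    using R_in by blast
  have "\<Omega> \<noteq> {}"
    using P_in by auto
  then obtain p where p: "p \<in> \<Omega>"
    by blast
  \<comment> \<open>The triangle lies only in the closure. The homothety of ratio 1/2 towards the
    interior point \<open>p\<close> brings it into \<Omega>.\<close>
  have half: "(1 / 2) *\<^sub>R (x + p) \<in> \<Omega>" if "x \<in> closure \<Omega>" for x
  proof -
    have "x - (1 / 2) *\<^sub>R (x - p) \<in> interior \<Omega>"
      using p that by (intro mem_interior_closure_convex_shrink convex_\<Omega>) (auto simp: open_\<Omega> interior_open)
    moreover have "x - (1 / 2) *\<^sub>R (x - p) = (1 / 2) *\<^sub>R (x + p)"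
      by (simp add: vec_eq_iff field_simps)
    ultimately show ?thesis
      using interior_subset by auto
  qed
  define b where "b = (1 / 2) *\<^sub>R (P + p)"
  define a where "a z = (z $ 1 * L / 2 + z $ 2 * r / 2) *\<^sub>R e1 + (z $ 2 * h / 2) *\<^sub>R e2" for z :: "real^3"
  \<comment> \<open>The first two coordinates are barycentric weights of the vertices other than the
    one at \<open>P\<close>; the bound 1/2 keeps their sum at most 1. The third coordinate measures
    the thickness in the direction \<open>n\<close>.\<close>
  define box where "box = cbox 0 (vector [1/2, 1/2, 1] :: real^3)"
  have boxD: "0 \<le> z $ 1" "z $ 1 \<le> 1/2" "0 \<le> z $ 2" "z $ 2 \<le> 1/2" "0 \<le> z $ 3" "z $ 3 \<le> 1" if "z \<in> box" for z
    using that unfolding box_def mem_box_cart by (auto simp: forall_3)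
  have a_in: "b + a z \<in> \<Omega>" if z: "z \<in> box" for z
  proof -
    have "(1 - z $ 1 - z $ 2) *\<^sub>R ((1 / 2) *\<^sub>R (P + p)) + z $ 1 *\<^sub>R ((1 / 2) *\<^sub>R ((P + L *\<^sub>R e1) + p))
        + z $ 2 *\<^sub>R ((1 / 2) *\<^sub>R ((P + r *\<^sub>R e1 + h *\<^sub>R e2) + p)) \<in> \<Omega>"
      using boxD[OF z] by (intro convex_combination_3 convex_\<Omega> half P_in Q_in r) auto
    also have "(1 - z $ 1 - z $ 2) *\<^sub>R ((1 / 2) *\<^sub>R (P + p)) + z $ 1 *\<^sub>R ((1 / 2) *\<^sub>R ((P + L *\<^sub>R e1) + p))
        + z $ 2 *\<^sub>R ((1 / 2) *\<^sub>R ((P + r *\<^sub>R e1 + h *\<^sub>R e2) + p)) = b + a z"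
      by (simp add: a_def b_def vec_eq_iff field_simps)
    finally show ?thesis .
  qed
  have "compact ((\<lambda>z. b + a z) ` box)"
    unfolding box_def a_def by (intro compact_continuous_image continuous_intros compact_cbox) simp_all
  then obtain d where d: "0 < d" "(\<Union>x\<in>(\<lambda>z. b + a z) ` box. ball x d) \<subseteq> \<Omega>"
    using compact_subset_open_imp_ball_epsilon_subset[of _ \<Omega>] open_\<Omega> a_in by blast
  \<comment> \<open>Half the margin around the parallelogram, so that thickening it by \<epsilon>
    stays inside \<Omega>.\<close>
  define \<epsilon> where "\<epsilon> = d / 2"
  have \<epsilon>: "0 < \<epsilon>" "\<epsilon> < d"
    using d by (auto simp: \<epsilon>_def)
  define f where "f z = a z + (z $ 3 * \<epsilon>) *\<^sub>R n" for z
  define S where "S = (+) b ` f ` box"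
  have S_sub: "S \<subseteq> \<Omega>"
  proof
    fix x assume "x \<in> S"
    then obtain z where z: "z \<in> box" "x = b + f z"
      by (auto simp: S_def)
    have "dist (b + a z) x = z $ 3 * \<epsilon>"
      using boxD[OF z(1)] \<epsilon> norm_n by (simp add: z(2) f_def dist_norm)
    also have "\<dots> \<le> 1 * \<epsilon>"
      using boxD[OF z(1)] \<epsilon> by (intro mult_right_mono) auto
    finally have "x \<in> ball (b + a z) d"
      using \<epsilon> by simp
    then show "x \<in> \<Omega>"
      using d z by blast
  qed
  have lin: "linear f"
    by (intro linearI) (simp_all add: f_def a_def algebra_simps add_divide_distrib)
  have box_m: "box \<in> lmeasurable" "measure lebesgue box = 1 / 4"
  proof -
    show "box \<in> lmeasurable"
      by (simp add: box_def)
    have "cbox 0 (vector [1/2, 1/2, 1] :: real^3) \<noteq> {}"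
      unfolding interval_ne_empty_cart by (simp add: forall_3)
    then have "measure lborel box = (\<Prod>i\<in>UNIV. (vector [1/2, 1/2, 1] :: real^3) $ i - 0 $ i)"
      unfolding box_def by (rule content_cbox_cart)
    moreover have "measure lebesgue box = measure lborel box"
      by (simp add: box_def)
    ultimately have "measure lebesgue box = (\<Prod>i\<in>UNIV. (vector [1/2, 1/2, 1] :: real^3) $ i - 0 $ i)"
      by (rule trans[rotated])
    also have "\<dots> = 1 / 4"
      unfolding UNIV_3 by simp
    finally show "measure lebesgue box = 1 / 4" .
  qed
  \<comment> \<open>Both edge vectors of the triangle were halved, hence the 4; the volume 1/4 of
    \<open>box\<close> then gives the 16 in the measure of \<open>S\<close>.\<close>
  have det_f: "\<bar>det (matrix f)\<bar> = L * h * \<epsilon> / 4"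
  proof -
    have "det (matrix f) = (L * h * \<epsilon> / 4) * (cross3 e1 e2 \<bullet> n)"
      unfolding det_3 by (simp add: matrix_def f_def a_def axis_def cross3_def inner_vec_def sum_3 field_simps)
    also have "cross3 e1 e2 \<bullet> n = 1"
      using n by (simp add: n_def)
    finally have "det (matrix f) = L * h * \<epsilon> / 4"
      by simp
    moreover have "0 \<le> L * h * \<epsilon> / 4"
      using L_pos h_pos \<epsilon> by simp
    ultimately show ?thesis
      by (simp only: abs_of_nonneg)
  qed
  have S_m: "S \<in> lmeasurable" "measure lebesgue S = L * h * \<epsilon> / 16"
  proof -
    have "f ` box \<in> lmeasurable"
      by (rule measurable_linear_image[OF lin box_m(1)])
    then show "S \<in> lmeasurable"
      unfolding S_def by (rule measurable_translation)
    show "measure lebesgue S = L * h * \<epsilon> / 16"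
      unfolding S_def by (simp add: measure_translation measure_linear_image[OF lin box_m(1)] det_f box_m)
  qed
  obtain B where B: "0 < B" "\<And>x. x \<in> \<Omega> \<Longrightarrow> norm x \<le> B"
    using bounded_\<Omega> by (meson bounded_pos)
  define \<tau> where "\<tau> x = (x - b) \<bullet> n / \<epsilon>" for x
  \<comment> \<open>A \<open>C1\<close> cut-off: it equals 1 on the ball of radius \<open>B\<close>,
    hence on \<Omega>, and vanishes once \<open>x \<bullet> x\<close> is at least
    \<open>B\<^sup>2 + 1\<close>.\<close>
  define \<kappa> where "\<kappa> x = posq (1 - posq (x \<bullet> x - B\<^sup>2))" for x :: "real^3"
  define \<kappa>' where "\<kappa>' x v = 2 * max 0 (1 - posq (x \<bullet> x - B\<^sup>2)) * (- (2 * max 0 (x \<bullet> x - B\<^sup>2) * (2 * (x \<bullet> v))))"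
    for x v :: "real^3"
  define F where "F x = (\<kappa> x * (arctan (\<tau> x) / 2)) *\<^sub>R n" for x
  define F' where "F' x v = (\<kappa> x * ((v \<bullet> n / \<epsilon>) / (1 + (\<tau> x)\<^sup>2) / 2) + \<kappa>' x v * (arctan (\<tau> x) / 2)) *\<^sub>R n" for x v
  have \<kappa>d: "(\<kappa> has_derivative \<kappa>' x) (at x)" for x
  proof -
    have "((\<lambda>x. x \<bullet> x - B\<^sup>2) has_derivative (\<lambda>v. 2 * (x \<bullet> v))) (at x)"
      by (auto intro!: derivative_eq_intros simp: inner_commute)
    from has_derivative_diff[OF has_derivative_const[of 1] posq_has_derivative[OF this]]
    have "((\<lambda>x. 1 - posq (x \<bullet> x - B\<^sup>2)) has_derivative (\<lambda>v. - (2 * max 0 (x \<bullet> x - B\<^sup>2) * (2 * (x \<bullet> v))))) (at x)"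
      by simp
    then show ?thesis
      unfolding \<kappa>_def[abs_def] \<kappa>'_def[abs_def] by (rule posq_has_derivative)
  qed
  have \<tau>d: "((\<lambda>x. arctan (\<tau> x)) has_derivative (\<lambda>v. (v \<bullet> n / \<epsilon>) / (1 + (\<tau> x)\<^sup>2))) (at x)" for x
  proof -
    have 1: "(\<tau> has_derivative (\<lambda>v. v \<bullet> n / \<epsilon>)) (at x)"
      unfolding \<tau>_def[abs_def] using \<epsilon> by (auto intro!: derivative_eq_intros)
    have "(arctan has_derivative (\<lambda>t. t / (1 + (\<tau> x)\<^sup>2))) (at (\<tau> x))"
      using DERIV_arctan[of "\<tau> x"] by (simp add: has_field_derivative_def divide_inverse mult.commute[of _ "inverse _"])
    from has_derivative_compose[OF 1 this] show ?thesis .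
  qed
  have Fd: "(F has_derivative F' x) (at x)" for x
  proof -
    have "((\<lambda>x. \<kappa> x * (arctan (\<tau> x) / 2)) has_derivative
        (\<lambda>v. \<kappa> x * ((v \<bullet> n / \<epsilon>) / (1 + (\<tau> x)\<^sup>2) / 2) + \<kappa>' x v * (arctan (\<tau> x) / 2))) (at x)"
      by (intro has_derivative_mult \<kappa>d bounded_linear.has_derivative[OF bounded_linear_divide \<tau>d])
    then show ?thesis
      unfolding F_def[abs_def] F'_def[abs_def] by (rule has_derivative_scaleR_left)
  qed
  have ne: "1 + y\<^sup>2 \<noteq> 0" for y :: real
    using zero_le_power2[of y] by linarith
  have "C1 F"
    using Fd
  proof (rule C1_I)
    show "continuous_on UNIV (\<lambda>x. F' x (axis i 1))" for i
      unfolding F'_def \<kappa>_def \<kappa>'_def \<tau>_def using \<epsilon> ne by (intro continuous_intros) auto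
  qed
  moreover have "compact (supp F)"
  proof (rule compact_supp)
    show "compact (cball 0 (B + 1) :: (real^3) set)"
      by simp
    fix x :: "real^3" assume "x \<notin> cball 0 (B + 1)"
    then have "(B + 1)\<^sup>2 \<le> (norm x)\<^sup>2"
      using B by (intro power_mono) auto
    then have "1 \<le> x \<bullet> x - B\<^sup>2"
      using B by (simp add: power2_norm_eq_inner power2_sum)
    then have "1\<^sup>2 \<le> (x \<bullet> x - B\<^sup>2)\<^sup>2"
      by (intro power_mono) auto
    then have "1 \<le> posq (x \<bullet> x - B\<^sup>2)"
      using \<open>1 \<le> x \<bullet> x - B\<^sup>2\<close> by (simp add: posq_def)
    then show "F x = 0"
      by (simp add: F_def \<kappa>_def posq_nonpos)
  qed
  moreover have "norm (F x) \<le> 1" for x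
  proof -
    have "\<kappa> x \<le> 1"
      unfolding \<kappa>_def posq_def by (intro power_le_one) auto
    moreover have "\<bar>arctan (\<tau> x) / 2\<bar> \<le> 1"
      using arctan_lbound[of "\<tau> x"] arctan_ubound[of "\<tau> x"] pi_less_4 by (simp add: abs_le_iff)
    ultimately have "\<kappa> x * \<bar>arctan (\<tau> x) / 2\<bar> \<le> 1 * 1"
      by (intro mult_mono) auto
    then show ?thesis
      by (simp add: F_def norm_n abs_mult \<kappa>_def)
  qed
  ultimately have "ereal (\<integral>x. divergence F x \<partial>M) \<le> perimeter \<Omega>"
    unfolding perimeter_def by (intro SUP_upper) auto
  moreover have "h * L / 64 \<le> (\<integral>x. divergence F x \<partial>M)"
  proof -
    define q where "q x = 1 / (2 * \<epsilon> * (1 + (\<tau> x)\<^sup>2))" for x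
    have div: "divergence F x = q x" if "x \<in> \<Omega>" for x
    proof -
      have "(norm x)\<^sup>2 \<le> B\<^sup>2"
        using B that by (intro power_mono) auto
      then have "x \<bullet> x - B\<^sup>2 \<le> 0"
        by (simp add: power2_norm_eq_inner)
      then have "\<kappa> x = 1" "\<kappa>' x v = 0" for v
        by (simp_all add: \<kappa>_def \<kappa>'_def posq_nonpos) (simp add: posq_def)
      then have "divergence F x = (\<Sum>i\<in>UNIV. (n $ i / \<epsilon> / (1 + (\<tau> x)\<^sup>2) / 2) * n $ i)"
        unfolding divergence_def partial_eqI[OF Fd] by (simp add: F'_def inner_axis')
      also have "\<dots> = (n \<bullet> n) * q x"
        unfolding inner_vec_def sum_distrib_right q_def by (intro sum.cong) (simp_all add: field_simps)
      finally show ?thesis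
        by (simp add: n)
    qed
    have q_cont: "continuous_on UNIV q"
      unfolding q_def \<tau>_def using \<epsilon> ne by (intro continuous_intros) auto
    interpret finite_measure M by (rule finite_M)
    have S_sets: "S \<in> sets M"
      using S_m S_sub open_\<Omega> by (simp add: sets_restrict_space_iff fmeasurableD)
    have q_le: "0 \<le> q x" "q x \<le> 1 / (2 * \<epsilon>)" for x
    proof -
      have "2 * \<epsilon> * 1 \<le> 2 * \<epsilon> * (1 + (\<tau> x)\<^sup>2)"
        using \<epsilon> by (intro mult_left_mono) auto
      then show "q x \<le> 1 / (2 * \<epsilon>)"
        unfolding q_def using \<epsilon> by (intro divide_left_mono mult_pos_pos) (auto simp: add_pos_nonneg)
      show "0 \<le> q x"
        using \<epsilon> by (simp add: q_def)
    qed
    have qi: "integrable M q"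
      using q_le by (intro integrable_const_bound[of _ "1 / (2 * \<epsilon>)"] AE_I2 continuous_lebesgue_on_measurable[OF q_cont]) auto
    have q_S: "1 / (4 * \<epsilon>) \<le> q x" if "x \<in> S" for x
    proof -
      obtain z where z: "z \<in> box" "x = b + f z"
        using \<open>x \<in> S\<close> by (auto simp: S_def)
      have "\<tau> x = z $ 3"
        using \<epsilon> n by (simp add: \<tau>_def z(2) f_def a_def inner_add_left)
      moreover have "(z $ 3)\<^sup>2 \<le> 1"
        using boxD[OF z(1)] by (intro power_le_one) auto
      ultimately show ?thesis
        using \<epsilon> unfolding q_def by (intro divide_left_mono mult_pos_pos) (auto simp: add_pos_nonneg)
    qed
    \<comment> \<open>On \<open>S\<close> the value \<tau> is at most 1, which costs only a factor 2
      in \<open>q\<close>. The \<epsilon> in the denominator cancels against the thickness of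
      \<open>S\<close>, so the margin drops out; elsewhere in \<Omega> the divergence is nonnegative
      and is discarded.\<close>
    have "h * L / 64 = measure lebesgue S * (1 / (4 * \<epsilon>))"
      unfolding S_m(2) using \<epsilon> by simp
    also have "\<dots> = (\<integral>x. indicator S x *\<^sub>R (1 / (4 * \<epsilon>)) \<partial>M)"
      using S_sets S_sub open_\<Omega> by (simp add: measure_restrict_space Int_absorb2)
    also have "\<dots> \<le> (\<integral>x. q x \<partial>M)"
    proof (rule integral_mono)
      show "integrable M (\<lambda>x. indicator S x *\<^sub>R (1 / (4 * \<epsilon>)))"
        using S_sets by (intro integrable_scaleR_left integrable_real_indicator) (auto simp: less_top[symmetric])
      show "indicator S x *\<^sub>R (1 / (4 * \<epsilon>)) \<le> q x" for x
        using q_le(1)[of x] q_S[of x] by (auto simp: indicator_def)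
    qed (rule qi)
    also have "\<dots> = (\<integral>x. divergence F x \<partial>M)"
      by (intro Bochner_Integration.integral_cong) (auto simp: div space_restrict_space)
    finally show ?thesis .
  qed
  ultimately show ?thesis
    using ereal_less_eq(3) order_trans by blast
qed

lemma J_Per_ge: "ereal (1 / 23040) \<le> J_Per \<Omega>"
proof -
  have "ereal (1 / 23040) = ereal (h * L / 64) * ereal (1 / (360 * (h * L)))"
    using h_pos L_pos by simp
  also have "\<dots> \<le> perimeter \<Omega> * maxwell_eigenvalue \<Omega>"
  proof (rule ereal_mult_mono)
    show "0 \<le> perimeter \<Omega>"
      using h_pos L_pos by (intro order_trans[OF _ perimeter_ge]) simp
  qed (use h_pos L_pos maxwell_eigenvalue_ge perimeter_ge in auto)
  finally show ?thesis
    by (simp add: J_Per_def)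
qed

end

section \<open>Existence of a frame\<close>

lemma thin_frame_exists:
  assumes "\<Omega> \<in> convex_domains"
  obtains P e1 e2 L h where "thin_frame \<Omega> P e1 e2 L h"
proof -
  have \<Omega>: "\<Omega> \<noteq> {}" "bounded \<Omega>" "open \<Omega>" "convex \<Omega>"
    using assms by (auto simp: convex_domains_def)
  have comp: "compact (closure \<Omega>)" and ne: "closure \<Omega> \<noteq> {}"
    using \<Omega> by auto
  have sub: "x \<in> closure \<Omega>" if "x \<in> \<Omega>" for x
    using that closure_subset by blast
  obtain P Q where PQ: "P \<in> closure \<Omega>" "Q \<in> closure \<Omega>"
    and max: "\<forall>x\<in>closure \<Omega>. \<forall>y\<in>closure \<Omega>. dist x y \<le> dist P Q"
    using compact_sup_maxdistance[OF comp ne] by blast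
  obtain p where p: "p \<in> \<Omega>"
    using \<Omega> by blast
  then obtain d where d: "0 < d" "ball p d \<subseteq> \<Omega>"
    using \<Omega> openE by blast
  have move: "p + (d / 2) *\<^sub>R a \<in> \<Omega>" if "norm a = 1" for a
    using d that by (auto simp: dist_norm subset_iff)
  define L where "L = dist P Q"
  have "0 < dist (p + (d / 2) *\<^sub>R axis 1 1) p"
    using d by (simp add: dist_norm)
  also have "\<dots> \<le> L"
    unfolding L_def using max sub move[of "axis 1 1"] p by auto
  finally have L: "0 < L" .
  define e1 where "e1 = (1 / L) *\<^sub>R (Q - P)"
  have n1: "norm e1 = 1"
    using L by (simp add: e1_def L_def dist_norm norm_minus_commute)
  then have u1: "e1 \<bullet> e1 = 1"
    by (simp add: norm_eq_1)
  have Q: "Q = P + L *\<^sub>R e1"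
    using L by (simp add: e1_def)
  define f where "f x = x - P - ((x - P) \<bullet> e1) *\<^sub>R e1" for x
  have fe: "f x \<bullet> e1 = 0" for x
    by (simp add: f_def inner_diff_left u1)
  have fn: "(norm (f x))\<^sup>2 = (norm (x - P))\<^sup>2 - ((x - P) \<bullet> e1)\<^sup>2" for x
    unfolding f_def power2_norm_eq_inner inner_diff_left[of "x - P"] inner_diff_right[of _ "x - P"]
    by (simp add: u1 power2_eq_square inner_commute)
  have "continuous_on (closure \<Omega>) (\<lambda>x. norm (f x))"
    unfolding f_def by (intro continuous_intros)
  then obtain R where R: "R \<in> closure \<Omega>" "\<And>x. x \<in> closure \<Omega> \<Longrightarrow> norm (f x) \<le> norm (f R)"
    using continuous_attains_sup[OF comp ne] by blast
  define h where "h = norm (f R)"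
  \<comment> \<open>The open set \<Omega> cannot lie in a line: moving \<open>p\<close> orthogonally
    to \<open>e1\<close> inside \<Omega> changes the value of \<open>f\<close>.\<close>
  have h: "0 < h"
  proof (rule ccontr)
    assume "\<not> 0 < h"
    then have z: "f x = 0" if "x \<in> \<Omega>" for x
      using R(2)[OF sub[OF that]] by (simp add: h_def)
    obtain y where y: "y \<noteq> 0" "orthogonal e1 y"
      using orthogonal_to_vector_exists[of e1] by auto
    define a where "a = (1 / norm y) *\<^sub>R y"
    have a: "norm a = 1" "a \<bullet> e1 = 0"
      using y by (auto simp: a_def orthogonal_def inner_commute)
    have "f (p + (d / 2) *\<^sub>R a) = f p + (d / 2) *\<^sub>R a"
      unfolding f_def using a by (simp add: inner_diff_left inner_add_left)
    then have "(d / 2) *\<^sub>R a = 0"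
      using z[OF p] z[OF move[OF a(1)]] by simp
    then show False
      using d a by auto
  qed
  have hL: "h \<le> L"
  proof -
    have "(norm (f R))\<^sup>2 \<le> (norm (R - P))\<^sup>2"
      by (simp add: fn)
    then have "norm (f R) \<le> norm (R - P)"
      by (rule power2_le_imp_le) simp
    also have "\<dots> \<le> L"
      using max PQ R by (simp add: L_def dist_norm)
    finally show ?thesis
      by (simp add: h_def)
  qed
  define e2 where "e2 = (1 / h) *\<^sub>R f R"
  have "norm e2 = 1"
    using h by (simp add: e2_def h_def)
  then have u2: "e2 \<bullet> e2 = 1"
    by (simp add: norm_eq_1)
  have u12: "e1 \<bullet> e2 = 0"
    using fe[of R] by (simp add: e2_def inner_commute)
  have len: "0 \<le> (x - P) \<bullet> e1 \<and> (x - P) \<bullet> e1 \<le> L" if x: "x \<in> closure \<Omega>" for x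
  proof
    have "(Q - x) \<bullet> e1 \<le> norm (Q - x) * norm e1"
      by (rule norm_cauchy_schwarz)
    also have "\<dots> \<le> L"
      using max PQ x n1 by (simp add: L_def dist_norm)
    finally show "0 \<le> (x - P) \<bullet> e1"
      by (simp add: Q inner_diff_left inner_add_left u1)
    have "(x - P) \<bullet> e1 \<le> norm (x - P) * norm e1"
      by (rule norm_cauchy_schwarz)
    also have "\<dots> \<le> L"
      using max PQ x n1 by (simp add: L_def dist_norm)
    finally show "(x - P) \<bullet> e1 \<le> L" .
  qed
  have "thin_frame \<Omega> P e1 e2 L h"
  proof
    show "P + L *\<^sub>R e1 \<in> closure \<Omega>"
      using PQ Q by simp
    have "P + ((R - P) \<bullet> e1) *\<^sub>R e1 + h *\<^sub>R e2 = R"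
      using h by (simp add: e2_def f_def)
    then show "\<exists>r. 0 \<le> r \<and> r \<le> L \<and> P + r *\<^sub>R e1 + h *\<^sub>R e2 \<in> closure \<Omega>"
      using len[OF R(1)] R(1) by metis
    fix x assume x: "x \<in> \<Omega>"
    show "norm (x - P - ((x - P) \<bullet> e1) *\<^sub>R e1) \<le> h"
      using R(2)[OF sub[OF x]] by (simp add: f_def h_def)
    obtain c where c: "0 < c" "ball x c \<subseteq> \<Omega>"
      using x \<Omega> openE by blast
    \<comment> \<open>Openness makes the bounds \<open>len\<close> strict: the point may be shifted
      both ways along \<open>e1\<close> without leaving \<Omega>.\<close>
    have in': "x + k *\<^sub>R e1 \<in> \<Omega>" if "\<bar>k\<bar> < c" for k
      using c that n1 by (auto simp: dist_norm subset_iff)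
    show "0 < (x - P) \<bullet> e1 \<and> (x - P) \<bullet> e1 < L"
      using len[OF sub[OF in'[of "c / 2"]]] len[OF sub[OF in'[of "- (c / 2)"]]] c
      by (simp add: inner_diff_left inner_add_left u1)
  qed (use \<Omega> u1 u2 u12 h hL PQ in auto)
  then show ?thesis
    by (rule that)
qed

theorem theorem1p2:
  "(INF \<Omega> \<in> convex_domains. J_Per \<Omega>) > 0"
proof -
  have "ereal (1 / 23040) \<le> (INF \<Omega> \<in> convex_domains. J_Per \<Omega>)"
  proof (rule INF_greatest)
    fix \<Omega> assume "\<Omega> \<in> convex_domains"
    then obtain P e1 e2 L h where "thin_frame \<Omega> P e1 e2 L h"
      by (rule thin_frame_exists)
    then show "ereal (1 / 23040) \<le> J_Per \<Omega>"
      by (rule thin_frame.J_Per_ge)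
  qed
  moreover have "(0 :: ereal) < ereal (1 / 23040)"
    by simp
  ultimately show ?thesis
    by (rule less_le_trans[rotated])
qed

end
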